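(* Let $W$ be the $2|1$-dimensional complex $\mathbb Z_2$-graded vector space with basis $w_1$ (odd), $w_2,w_3$ (even), and let $d_\sharp=\psi^{1,1,0}_2+\psi^{1,1,0}_3+\psi^{1,0,1}_3$. Then the cohomology of $d_\sharp$ has the following bases (the listed elements are cocycles whose classes form a basis): $$H^1=\langle\psi^{1,0,0}_2,\ \psi^{1,0,0}_3,\ \varphi^{0,1,0}_3,\ \varphi^{0,1,0}_2+\varphi^{0,0,1}_3\rangle,\qquad H^2=\langle\psi^{1,0,1}_2\rangle,\qquad H^n=0\ \text{ for } n>2.$$
   Context: All spaces are $\mathbb Z_2$-graded over $\mathbb C$. $S(W)=\bigoplus_{n\ge1}S^n(W)$ is the symmetric coalgebra of $W$ (so $w_1^2=0$). $L_n=\mathrm{Hom}(S^n(W),W)$ for $n\ge1$, $L_0=0$, and $L=\prod_{n\ge1}L_n$ is identified with the coderivations of $S(W)$; it is a $\mathbb Z_2$-graded Lie algebra under the graded commutator $[\cdot,\cdot]$. For a multi-index $I=(i_1,i_2,i_3)$ with $i_1\in\{0,1\}$, $i_2,i_3\ge0$, put $w_I=w_1^{i_1}w_2^{i_2}w_3^{i_3}$, $I!=i_1!i_2!i_3!$, and let $\varphi^I_j\in\mathrm{Hom}(S^{|I|}(W),W)$ be given by $\varphi^I_j(w_J)=I!\,\delta^I_J\,w_j$; when this element is odd it is written $\psi^I_j$. For a codifferential $d\in L_2$ (odd, $[d,d]=0$) let $D(\varphi)=[\varphi,d]$, which maps $L_n$ to $L_{n+1}$ and satisfies $D^2=0$;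 $H^n=\ker(D:L_n\to L_{n+1})/D(L_{n-1})$ for $n\ge1$. *)

theory Defs
  imports "HOL-Analysis.Analysis" "HOL-Library.Poly_Mapping" "HOL-Library.Function_Algebras"
begin

text \<open>
  The space \<open>W\<close> is \<open>complex^3\<close> with basis \<open>w\<^sub>j = axis j 1\<close>; \<open>w\<^sub>1\<close> is odd, \<open>w\<^sub>2\<close> and \<open>w\<^sub>3\<close> are even.
  (In the index type \<open>3\<close> the numeral \<open>3\<close> denotes the same element as \<open>0\<close>.)
  The monomials \<open>w\<^sub>I\<close> with \<open>i\<^sub>1 \<le> 1\<close> and \<open>\<bar>I\<bar> \<ge> 1\<close> form a basis of \<open>S(W)\<close>, which is therefore modelled as
  the space of finitely supported functions on these multi-indices.
\<close>

type_synonym W = "complex^3"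

typedef midx = "{I :: nat^3. I $ 1 \<le> 1 \<and> I \<noteq> 0}"
  morphisms expo Midx
  by (rule exI[of _ "axis 1 1"]) (simp add: axis_eq_0_iff)

type_synonym SW = "midx \<Rightarrow>\<^sub>0 complex"

definition total :: "nat^3 \<Rightarrow> nat" where
  "total I = (\<Sum>j\<in>UNIV. I $ j)"

definition mfact :: "nat^3 \<Rightarrow> nat" where
  "mfact I = (\<Prod>j\<in>UNIV. fact (I $ j))"

definition mbinom :: "nat^3 \<Rightarrow> nat^3 \<Rightarrow> nat" where
  "mbinom I J = (\<Prod>j\<in>UNIV. (I $ j) choose (J $ j))"

definition par :: "midx \<Rightarrow> nat" where
  "par I = expo I $ 1"

definition pscale :: "complex \<Rightarrow> ('a \<Rightarrow>\<^sub>0 complex) \<Rightarrow> ('a \<Rightarrow>\<^sub>0 complex)" where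
  "pscale c x = Poly_Mapping.map ((*) c) x"

definition wmon :: "midx \<Rightarrow> SW" where
  "wmon I = Poly_Mapping.single I 1"

definition linext :: "('a \<Rightarrow> 'b \<Rightarrow>\<^sub>0 complex) \<Rightarrow> ('a \<Rightarrow>\<^sub>0 complex) \<Rightarrow> ('b \<Rightarrow>\<^sub>0 complex)" where
  "linext f x = (\<Sum>i\<in>Poly_Mapping.keys x. pscale (Poly_Mapping.lookup x i) (f i))"

text \<open>The projection \<open>S(W) \<rightarrow> S\<^sup>1(W) = W\<close>.\<close>

definition proj1 :: "SW \<Rightarrow> W" where
  "proj1 x = (\<chi> j. Poly_Mapping.lookup x (Midx (axis j 1)))"

text \<open>
  The tensor square of \<open>S(W)\<close> has the basis \<open>w\<^sub>J \<otimes> w\<^sub>K\<close>, indexed by pairs.  The coproduct is the sum over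
  all unshuffles with both parts nonempty.  As \<open>w\<^sub>1\<close> is the only odd generator and occurs at most once
  in a monomial, no unshuffle exchanges two odd factors: all Koszul signs are \<open>1\<close>, and collecting
  equal terms gives binomial coefficients.
\<close>

definition tensor :: "SW \<Rightarrow> SW \<Rightarrow> (midx \<times> midx \<Rightarrow>\<^sub>0 complex)" where
  "tensor x y = (\<Sum>J\<in>Poly_Mapping.keys x. \<Sum>K\<in>Poly_Mapping.keys y.
     Poly_Mapping.single (J, K) (Poly_Mapping.lookup x J * Poly_Mapping.lookup y K))"

definition comult :: "SW \<Rightarrow> (midx \<times> midx \<Rightarrow>\<^sub>0 complex)" where
  "comult = linext (\<lambda>I. \<Sum>(J, K) | expo J + expo K = expo I.
     pscale (of_nat (mbinom (expo I) (expo J))) (tensor (wmon J) (wmon K)))"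

text \<open>Parities are \<open>0\<close> and \<open>1\<close>; \<open>hpart p f\<close> is the component of parity \<open>p\<close> of a linear map \<open>f\<close>.\<close>

definition parproj :: "nat \<Rightarrow> SW \<Rightarrow> SW" where
  "parproj p = linext (\<lambda>I. if par I = p then wmon I else 0)"

definition hpart :: "nat \<Rightarrow> (SW \<Rightarrow> SW) \<Rightarrow> SW \<Rightarrow> SW" where
  "hpart p f x = (\<Sum>q\<in>{0, 1}. parproj ((p + q) mod 2) (f (parproj q x)))"

text \<open>
  A coderivation satisfies \<open>\<Delta>\<delta> = (\<delta> \<otimes> 1 + 1 \<otimes> \<delta>)\<Delta>\<close>, where
  \<open>(1 \<otimes> \<delta>)(u \<otimes> v) = (-1)\<^bsup>\<bar>\<delta>\<bar>\<bar>u\<bar>\<^esup> u \<otimes> \<delta>(v)\<close> for homogeneous \<open>\<delta>\<close> and \<open>u\<close>.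
\<close>

definition coder_sum :: "(SW \<Rightarrow> SW) \<Rightarrow> (midx \<times> midx \<Rightarrow>\<^sub>0 complex) \<Rightarrow> (midx \<times> midx \<Rightarrow>\<^sub>0 complex)" where
  "coder_sum \<delta> = linext (\<lambda>(J, K). tensor (\<delta> (wmon J)) (wmon K) +
     (\<Sum>p\<in>{0, 1}. pscale ((- 1) ^ (p * par J)) (tensor (wmon J) (hpart p \<delta> (wmon K)))))"

definition coderivation :: "(SW \<Rightarrow> SW) \<Rightarrow> bool" where
  "coderivation \<delta> \<longleftrightarrow> Vector_Spaces.linear pscale pscale \<delta> \<and>
     (\<forall>x. comult (\<delta> x) = coder_sum \<delta> (comult x))"

text \<open>The identification of \<open>Hom(S(W), W)\<close> with the coderivations of \<open>S(W)\<close>.\<close>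

definition coext :: "(SW \<Rightarrow> W) \<Rightarrow> SW \<Rightarrow> SW" where
  "coext \<phi> = (THE \<delta>. coderivation \<delta> \<and> (\<forall>x. proj1 (\<delta> x) = \<phi> x))"

definition gcomm :: "(SW \<Rightarrow> SW) \<Rightarrow> (SW \<Rightarrow> SW) \<Rightarrow> SW \<Rightarrow> SW" where
  "gcomm f g x = (\<Sum>p\<in>{0, 1}. \<Sum>q\<in>{0, 1}.
     hpart p f (hpart q g x) - pscale ((- 1) ^ (p * q)) (hpart q g (hpart p f x)))"

definition bracket :: "(SW \<Rightarrow> W) \<Rightarrow> (SW \<Rightarrow> W) \<Rightarrow> SW \<Rightarrow> W" where
  "bracket \<phi> \<psi> x = proj1 (gcomm (coext \<phi>) (coext \<psi>) x)"

text \<open>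
  An element of \<open>L\<^sub>n = Hom(S\<^sup>n(W), W)\<close> is extended by zero to the other \<open>S\<^sup>m(W)\<close>.
  Since multi-indices are nonzero, \<open>L\<^sub>0 = 0\<close>.
\<close>

definition L :: "nat \<Rightarrow> (SW \<Rightarrow> W) set" where
  "L n = {\<phi>. Vector_Spaces.linear pscale (*s) \<phi> \<and> (\<forall>I. total (expo I) \<noteq> n \<longrightarrow> \<phi> (wmon I) = 0)}"

definition phi :: "nat \<times> nat \<times> nat \<Rightarrow> 3 \<Rightarrow> SW \<Rightarrow> W" where
  "phi = (\<lambda>(i1, i2, i3) j x. let I = vector [i1, i2, i3] in
     (of_nat (mfact I) * Poly_Mapping.lookup x (Midx I)) *s axis j 1)"

text \<open>\<open>\<psi>\<close> is the name of the same cochain when it is odd.\<close>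

abbreviation (input) "psi \<equiv> phi"

definition D :: "(SW \<Rightarrow> W) \<Rightarrow> (SW \<Rightarrow> W) \<Rightarrow> SW \<Rightarrow> W" where
  "D d \<phi> = bracket \<phi> d"

definition cocycles :: "(SW \<Rightarrow> W) \<Rightarrow> nat \<Rightarrow> (SW \<Rightarrow> W) set" where
  "cocycles d n = {\<phi> \<in> L n. D d \<phi> = 0}"

text \<open>The cohomology is only considered for \<open>n \<ge> 1\<close>.\<close>

definition coboundaries :: "(SW \<Rightarrow> W) \<Rightarrow> nat \<Rightarrow> (SW \<Rightarrow> W) set" where
  "coboundaries d n = D d ` L (n - 1)"

definition cls :: "(SW \<Rightarrow> W) \<Rightarrow> nat \<Rightarrow> (SW \<Rightarrow> W) \<Rightarrow> (SW \<Rightarrow> W) set" where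
  "cls d n z = {z + b |b. b \<in> coboundaries d n}"

definition H :: "(SW \<Rightarrow> W) \<Rightarrow> nat \<Rightarrow> (SW \<Rightarrow> W) set set" where
  "H d n = cls d n ` cocycles d n"

definition lincomb :: "complex list \<Rightarrow> (SW \<Rightarrow> W) list \<Rightarrow> SW \<Rightarrow> W" where
  "lincomb cs bs x = (\<Sum>i<length bs. cs ! i *s (bs ! i) x)"

text \<open>
  The entries of \<open>bs\<close> are cocycles whose classes are linearly independent in \<open>H\<^sup>n\<close> and span it; a linear
  combination of classes is the class of the linear combination, and the zero of \<open>H\<^sup>n\<close> is \<open>cls d n 0\<close>.
\<close>

definition cohomology_basis :: "(SW \<Rightarrow> W) \<Rightarrow> nat \<Rightarrow> (SW \<Rightarrow> W) list \<Rightarrow> bool" where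
  "cohomology_basis d n bs \<longleftrightarrow> set bs \<subseteq> cocycles d n \<and>
     (\<forall>cs. length cs = length bs \<and> cls d n (lincomb cs bs) = cls d n 0 \<longrightarrow> (\<forall>c\<in>set cs. c = 0)) \<and>
     (\<forall>h\<in>H d n. \<exists>cs. length cs = length bs \<and> h = cls d n (lincomb cs bs))"

definition d_sharp :: "SW \<Rightarrow> W" where
  "d_sharp = psi (1, 1, 0) 2 + psi (1, 1, 0) 3 + psi (1, 0, 1) 3"

text \<open>
  The rest of the theory shows that every linear map \<open>\<phi> : S(W) \<rightarrow> W\<close> is the corestriction of exactly one
  coderivation, so that \<open>coext \<phi>\<close> is well defined (lemma \<open>coext_eq\<close>).
\<close>

lemma lookup_pscale [simp]: "Poly_Mapping.lookup (pscale c x) i = c * Poly_Mapping.lookup x i"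
  by (simp add: pscale_def map.rep_eq when_def)

lemma vector_space_pscale: "vector_space pscale"
  by unfold_locales (auto intro!: poly_mapping_eqI simp: lookup_add algebra_simps)

interpretation pscale: vector_space "pscale :: complex \<Rightarrow> ('a \<Rightarrow>\<^sub>0 complex) \<Rightarrow> _" by (rule vector_space_pscale)

lemma linear_PI:
  assumes "\<And>x y. f (x + y) = f x + f y" "\<And>c x. f (pscale c x) = pscale c (f x)"
  shows "Vector_Spaces.linear pscale pscale f"
  using assms by unfold_locales auto

lemma linext_superset:
  assumes "finite A" "Poly_Mapping.keys x \<subseteq> A"
  shows "linext f x = (\<Sum>i\<in>A. pscale (Poly_Mapping.lookup x i) (f i))"
  unfolding linext_def using assms
  by (intro sum.mono_neutral_left) (auto simp: in_keys_iff)

lemma linext_linear: "Vector_Spaces.linear pscale pscale (linext f)"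
proof (rule linear_PI)
  fix x y :: "'a \<Rightarrow>\<^sub>0 complex"
  let ?A = "Poly_Mapping.keys x \<union> Poly_Mapping.keys y"
  have "linext f (x + y) = (\<Sum>i\<in>?A. pscale (Poly_Mapping.lookup (x + y) i) (f i))"
    by (intro linext_superset keys_add) auto
  also have "\<dots> = linext f x + linext f y"
    by (subst (1 2) linext_superset[of ?A]) (auto simp: lookup_add pscale.scale_left_distrib sum.distrib)
  finally show "linext f (x + y) = linext f x + linext f y" .
next
  fix c x
  have "linext f (pscale c x) = (\<Sum>i\<in>Poly_Mapping.keys x. pscale (Poly_Mapping.lookup (pscale c x) i) (f i))"
    by (intro linext_superset) (auto simp: in_keys_iff)
  then show "linext f (pscale c x) = pscale c (linext f x)"
    by (simp add: linext_def pscale.scale_sum_right)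
qed

lemma linext_single: "linext f (Poly_Mapping.single i c) = pscale c (f i)"
  by (subst linext_superset[of "{i}"]) auto

lemma lookup_linext:
  "Poly_Mapping.lookup (linext f x) p = (\<Sum>i\<in>Poly_Mapping.keys x. Poly_Mapping.lookup x i * Poly_Mapping.lookup (f i) p)"
  by (simp add: linext_def lookup_sum)

lemma linext_wmon [simp]: "linext f (wmon i) = f i"
  by (simp add: wmon_def linext_single)

lemma linext_zero [simp]: "linext f 0 = 0"
  by (simp add: linext_def)

lemma lin_eqI:
  assumes f: "Vector_Spaces.linear pscale s f" and g: "Vector_Spaces.linear pscale s g"
    and eq: "\<And>i. f (Poly_Mapping.single i 1) = g (Poly_Mapping.single i 1)"
  shows "f x = g x"
proof -
  interpret f: Vector_Spaces.linear pscale s f by (rule f)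
  interpret g: Vector_Spaces.linear pscale s g by (rule g)
  have x: "x = (\<Sum>i\<in>Poly_Mapping.keys x. pscale (Poly_Mapping.lookup x i) (Poly_Mapping.single i 1))"
    by (intro poly_mapping_eqI)
      (auto simp: lookup_sum lookup_single when_def in_keys_iff if_distrib sum.delta cong: if_cong)
  show ?thesis
    by (subst (1 2) x) (simp add: f.sum g.sum f.scale g.scale eq)
qed

lemma lin0: "Vector_Spaces.linear pscale s f \<Longrightarrow> f 0 = 0"
proof -
  assume "Vector_Spaces.linear pscale s f"
  then interpret Vector_Spaces.linear pscale s f .
  show "f 0 = 0" by (rule zero)
qed

lemma lookup_tensor [simp]: "Poly_Mapping.lookup (tensor x y) p = Poly_Mapping.lookup x (fst p) * Poly_Mapping.lookup y (snd p)"
proof (cases p)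
  case (Pair J K)

  have "Poly_Mapping.lookup (tensor x y) (J, K) = (\<Sum>J'\<in>Poly_Mapping.keys x. \<Sum>K'\<in>Poly_Mapping.keys y.
     if K' = K then if J' = J then Poly_Mapping.lookup x J * Poly_Mapping.lookup y K else 0 else 0)"
    by (auto simp: tensor_def lookup_sum lookup_single when_def intro!: sum.cong)
  also have "\<dots> = (\<Sum>J'\<in>Poly_Mapping.keys x. if J' = J then Poly_Mapping.lookup x J * Poly_Mapping.lookup y K else 0)"
    by (intro sum.cong refl) (auto simp: sum.delta in_keys_iff)
  also have "\<dots> = Poly_Mapping.lookup x J * Poly_Mapping.lookup y K"
    by (auto simp: sum.delta in_keys_iff)
  finally show ?thesis by (simp add: Pair)
qed

lemma tensor_add1: "tensor (x + y) z = tensor x z + tensor y z"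
  and tensor_add2: "tensor z (x + y) = tensor z x + tensor z y"
  and tensor_scale1: "tensor (pscale c x) z = pscale c (tensor x z)"
  and tensor_scale2: "tensor z (pscale c x) = pscale c (tensor z x)"
  and tensor_0 [simp]: "tensor 0 z = 0" "tensor z 0 = 0"
  by (auto intro!: poly_mapping_eqI simp: lookup_add algebra_simps)

lemma tensor_sum1: "tensor (sum f A) z = (\<Sum>i\<in>A. tensor (f i) z)"
  by (induction A rule: infinite_finite_induct) (auto simp: tensor_add1)
lemma tensor_sum2: "tensor z (sum f A) = (\<Sum>i\<in>A. tensor z (f i))"
  by (induction A rule: infinite_finite_induct) (auto simp: tensor_add2)

definition valid :: "nat^3 \<Rightarrow> bool" where "valid I \<longleftrightarrow> I $ 1 \<le> 1 \<and> I \<noteq> 0"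

lemma valid_expo [simp]: "valid (expo I)"
  using expo[of I] by (simp add: valid_def)

lemma expo_Midx [simp]: "valid I \<Longrightarrow> expo (Midx I) = I"
  by (simp add: Midx_inverse valid_def)

lemma Midx_eq_iff: "valid I \<Longrightarrow> Midx I = J \<longleftrightarrow> I = expo J"
  by (metis expo_Midx expo_inverse)

lemma Midx_inj: "valid A \<Longrightarrow> valid B \<Longrightarrow> Midx A = Midx B \<longleftrightarrow> A = B"
  by (metis expo_Midx)

definition dpow :: "nat^3 \<Rightarrow> SW" where
  "dpow I = (if valid I then Poly_Mapping.single (Midx I) (1 / of_nat (mfact I)) else 0)"

definition splittings :: "nat^3 \<Rightarrow> ((nat^3) \<times> (nat^3)) set" where
  "splittings I = {(J, K). J + K = I}"

lemma mfact_pos [simp]: "mfact I > 0" "mfact I \<noteq> 0"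
  by (simp_all add: mfact_def)

lemma e_expo: "dpow (expo I) = pscale (1 / of_nat (mfact (expo I))) (wmon I)"
  by (auto simp: dpow_def wmon_def expo_inverse lookup_single when_def intro!: poly_mapping_eqI)

lemma wmon_e: "wmon I = pscale (of_nat (mfact (expo I))) (dpow (expo I))"
  by (simp add: e_expo)

lemma finite_splittings [simp]: "finite (splittings I)"
proof -
  let ?B = "(\<lambda>f. \<chi> j. f j) ` (PiE UNIV (\<lambda>j. {..I $ j}))"
  have "splittings I \<subseteq> ?B \<times> ?B"
  proof clarify
    fix J K assume "(J, K) \<in> splittings I"
    then have *: "I = J + K" by (simp add: splittings_def)
    have "J = (\<chi> j. (($) J) j)" "K = (\<chi> j. (($) K) j)" by (auto simp: vec_eq_iff)
    then show "J \<in> ?B \<and> K \<in> ?B" using *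
      by (metis (no_types, lifting) PiE_UNIV_domain Pi_I atMost_iff image_eqI le_add1 le_add2 vector_add_component)
  qed
  moreover have "finite (?B \<times> ?B)" by (intro finite_cartesian_product finite_imageI finite_PiE) auto
  ultimately show ?thesis by (rule finite_subset)
qed

lemma finite_expo_splittings [simp]: "finite {(J, K). expo J + expo K = expo I}"
proof -
  have "{(J, K). expo J + expo K = expo I} \<subseteq> (\<lambda>(A,B). (Midx A, Midx B)) ` splittings (expo I)"
    by (auto simp: splittings_def image_def) (metis expo_inverse)
  then show ?thesis by (rule finite_subset) auto
qed

lemma mbinom_fact: "J + K = I \<Longrightarrow> of_nat (mbinom I J) = (of_nat (mfact I) / (of_nat (mfact J) * of_nat (mfact K)) :: complex)"
  by (auto simp: mbinom_def mfact_def binomial_fact prod_dividef prod.distrib)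

lemma comult_wmon: "comult (wmon I) = pscale (of_nat (mfact (expo I))) (\<Sum>(A,B)\<in>splittings (expo I). tensor (dpow A) (dpow B))"
proof -
  let ?S = "{(J, K). expo J + expo K = expo I}"
  have "(\<Sum>(A,B)\<in>splittings (expo I). tensor (dpow A) (dpow B)) =
     (\<Sum>(A,B)\<in>(\<lambda>(J,K). (expo J, expo K)) ` ?S. tensor (dpow A) (dpow B))"
  proof (intro sum.mono_neutral_right ballI)
    show "(\<lambda>(J,K). (expo J, expo K)) ` ?S \<subseteq> splittings (expo I)" by (auto simp: splittings_def)
    fix p assume p: "p \<in> splittings (expo I) - (\<lambda>(J,K). (expo J, expo K)) ` ?S"
    obtain A B where AB: "p = (A, B)" by (cases p)
    have "\<not> (valid A \<and> valid B)"
    proof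
      assume "valid A \<and> valid B"
      then have "p = (expo (Midx A), expo (Midx B))" "A + B = expo I" using p by (auto simp: AB splittings_def)
      with p AB show False by (auto simp: image_def) metis
    qed
    then show "(case p of (A,B) \<Rightarrow> tensor (dpow A) (dpow B)) = 0" by (auto simp: AB dpow_def)
  qed auto
  also have "\<dots> = (\<Sum>(J,K)\<in>?S. tensor (dpow (expo J)) (dpow (expo K)))"
    by (subst sum.reindex) (auto simp: inj_on_def expo_inject intro!: sum.cong)
  finally show ?thesis
    by (auto simp: comult_def pscale.scale_sum_right e_expo tensor_scale1 tensor_scale2 mbinom_fact intro!: sum.cong)
qed

lemma par_proj_e: "parproj q (dpow I) = (if I $ 1 = q then dpow I else 0)"
  by (auto simp: parproj_def dpow_def par_def linext_single wmon_def intro!: poly_mapping_eqI simp: lookup_single when_def)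

abbreviation unitv :: "3 \<Rightarrow> nat^3" where "unitv j \<equiv> axis j 1"

text \<open>
  In the divided powers \<open>w\<^sub>I / I!\<close> the coderivation extending \<open>\<phi>\<close> sends the \<open>I\<close>-th one to the sum of
  \<open>\<phi>(w\<^sub>J / J!) \<cdot> w\<^sub>K / K!\<close> over all \<open>J + K = I\<close>.
\<close>

definition coext_formula :: "(SW \<Rightarrow> W) \<Rightarrow> SW \<Rightarrow> SW" where
  "coext_formula \<phi> = linext (\<lambda>I. pscale (of_nat (mfact (expo I))) (\<Sum>(J, K)\<in>splittings (expo I). \<Sum>j\<in>UNIV.
     pscale (\<phi> (dpow J) $ j * of_nat (K $ j + 1)) (dpow (K + unitv j))))"

lemma linext_linear_simps:
  "linext f (x + y) = linext f x + linext f y"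
  "linext f (pscale c x) = pscale c (linext f x)"
  "linext f (sum g A) = (\<Sum>i\<in>A. linext f (g i))"
proof -
  interpret Vector_Spaces.linear pscale pscale "linext f" by (rule linext_linear)
  show "linext f (x + y) = linext f x + linext f y"
  "linext f (pscale c x) = pscale c (linext f x)"
  "linext f (sum g A) = (\<Sum>i\<in>A. linext f (g i))" by (simp_all add: add scale sum)
qed

lemma valid_e: "valid I \<Longrightarrow> dpow I = pscale (1 / of_nat (mfact I)) (wmon (Midx I))"
  using e_expo[of "Midx I"] by simp

lemma ext_e:
  assumes "valid I"
  shows "coext_formula \<phi> (dpow I) = (\<Sum>(J, K)\<in>splittings I. \<Sum>j\<in>UNIV. pscale (\<phi> (dpow J) $ j * of_nat (K $ j + 1)) (dpow (K + unitv j)))"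
  using assms by (simp add: coext_formula_def valid_e[of I] linext_linear_simps)

lemma ext_e':
  assumes "I $ 1 \<le> 1" "\<phi> 0 = 0"
  shows "coext_formula \<phi> (dpow I) = (\<Sum>(J, K)\<in>splittings I. \<Sum>j\<in>UNIV. pscale (\<phi> (dpow J) $ j * of_nat (K $ j + 1)) (dpow (K + unitv j)))"
proof (cases "valid I")
  case False
  then have I: "I = 0" using assms by (simp add: valid_def)
  have "splittings 0 = {(0, 0)}" by (auto simp: splittings_def vec_eq_iff)
  then show ?thesis by (simp add: I dpow_def valid_def coext_formula_def assms)
qed (rule ext_e)

lemma comult_e: "valid I \<Longrightarrow> comult (dpow I) = (\<Sum>(A,B)\<in>splittings I. tensor (dpow A) (dpow B))"
  using comult_wmon[of "Midx I"] by (simp add: valid_e[of I] comult_def linext_linear_simps)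

lemma parproj_lin: "Vector_Spaces.linear pscale pscale (parproj p)"
  unfolding parproj_def by (rule linext_linear)

lemma hpart_lin:
  assumes "Vector_Spaces.linear pscale pscale f"
  shows "Vector_Spaces.linear pscale pscale (hpart p f)"
proof -
  interpret f: Vector_Spaces.linear pscale pscale f by fact
  show ?thesis
    by (rule linear_PI) (simp_all add: hpart_def parproj_def linext_linear_simps f.add f.scale pscale.scale_right_distrib)
qed

lemma ext_lin: "Vector_Spaces.linear pscale pscale (coext_formula \<phi>)"
  unfolding coext_formula_def by (rule linext_linear)

lemma coder_sum_tensor:
  assumes f: "Vector_Spaces.linear pscale pscale f"
  shows "coder_sum f (tensor (dpow A) (dpow B)) = tensor (f (dpow A)) (dpow B) +
     (\<Sum>p\<in>{0,1}. pscale ((- 1) ^ (p * A $ 1)) (tensor (dpow A) (hpart p f (dpow B))))"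
proof -
  interpret f: Vector_Spaces.linear pscale pscale f by fact
  interpret h: Vector_Spaces.linear pscale pscale "hpart p f" for p by (rule hpart_lin) fact
  have t: "tensor (wmon J) (wmon K) = Poly_Mapping.single (J, K) 1" for J K
    by (auto intro!: poly_mapping_eqI simp: wmon_def lookup_single when_def)
  show ?thesis
  proof (cases "valid A \<and> valid B")
    case True
    then show ?thesis
      by (simp add: valid_e tensor_scale1 tensor_scale2 coder_sum_def linext_linear_simps t linext_single
         f.scale h.scale par_def pscale.scale_right_distrib mult_ac)
  next
    case False
    then show ?thesis by (auto simp: dpow_def coder_sum_def f.zero h.zero)
  qed
qed

lemma par_arith:
  fixes a b c i p :: nat
  assumes "i = a + b" "i \<le> 1" "b + c \<le> 1" "p < 2"
  shows "(p + i) mod 2 = b + c \<longleftrightarrow> (a + c) mod 2 = p"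
proof -
  have "a \<in> {0,1}" "b \<in> {0,1}" "c \<in> {0,1}" "p \<in> {0,1}" using assms by auto
  then show ?thesis using assms by auto
qed

lemma parproj_ext_e:
  assumes "valid I" "p < 2" "(J, K) \<in> splittings I"
  shows "parproj ((p + I $ 1) mod 2) (dpow (K + unitv j)) = (if (J $ 1 + unitv j $ 1) mod 2 = p then dpow (K + unitv j) else 0)"
proof (cases "valid (K + unitv j)")
  case True
  have "I $ 1 = J $ 1 + K $ 1" using assms by (auto simp: splittings_def)
  moreover have "I $ 1 \<le> 1" "K $ 1 + unitv j $ 1 \<le> 1" using assms True by (auto simp: valid_def)
  ultimately have "(p + I $ 1) mod 2 = K $ 1 + unitv j $ 1 \<longleftrightarrow> (J $ 1 + unitv j $ 1) mod 2 = p"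
    using \<open>p < 2\<close> by (rule par_arith)
  then show ?thesis by (auto simp: par_proj_e)
qed (simp add: dpow_def parproj_def)

lemma hpart_ext_e:
  assumes "valid I" "p < 2"
  shows "hpart p (coext_formula \<phi>) (dpow I) = (\<Sum>(J, K)\<in>splittings I. \<Sum>j\<in>UNIV. pscale (\<phi> (dpow J) $ j * of_nat (K $ j + 1))
     (if (J $ 1 + unitv j $ 1) mod 2 = p then dpow (K + unitv j) else 0))"
proof -
  interpret pp: Vector_Spaces.linear pscale pscale "parproj r" for r by (rule parproj_lin)
  interpret ex: Vector_Spaces.linear pscale pscale "coext_formula \<phi>" by (rule ext_lin)
  have I: "I $ 1 = 0 \<or> I $ 1 = 1" using assms by (auto simp: valid_def)
  have "hpart p (coext_formula \<phi>) (dpow I) = parproj ((p + I $ 1) mod 2) (coext_formula \<phi> (dpow I))"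
    using I by (auto simp: hpart_def par_proj_e ex.zero pp.zero)
  also have "\<dots> = (\<Sum>(J, K)\<in>splittings I. \<Sum>j\<in>UNIV. pscale (\<phi> (dpow J) $ j * of_nat (K $ j + 1))
     (if (J $ 1 + unitv j $ 1) mod 2 = p then dpow (K + unitv j) else 0))"
    using assms by (auto simp: ext_e pp.sum pp.scale parproj_ext_e[of I] simp del: One_nat_def intro!: sum.cong)
  finally show ?thesis .
qed

lemma ext_sign:
  assumes "valid I" "\<phi> 0 = 0"
  shows "(\<Sum>p\<in>{0,1}. pscale ((- 1) ^ (p * a)) (tensor x (hpart p (coext_formula \<phi>) (dpow I)))) =
    (\<Sum>(J, K)\<in>splittings I. \<Sum>j\<in>UNIV. pscale (\<phi> (dpow J) $ j * of_nat (K $ j + 1) * (- 1) ^ ((J $ 1 + unitv j $ 1) * a)) (tensor x (dpow (K + unitv j))))"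
proof -
  have "(\<Sum>p\<in>{0,1}. pscale ((- 1) ^ (p * a)) (tensor x (hpart p (coext_formula \<phi>) (dpow I)))) =
    (\<Sum>p\<in>{0,1}. (\<Sum>(J, K)\<in>splittings I. \<Sum>j\<in>UNIV. pscale ((- 1) ^ (p * a)) (pscale (\<phi> (dpow J) $ j * of_nat (K $ j + 1))
     (if (J $ 1 + unitv j $ 1) mod 2 = p then tensor x (dpow (K + unitv j)) else 0))))"
    using assms
    by (auto simp: hpart_ext_e tensor_sum2 tensor_scale2 pscale.scale_sum_right case_prod_unfold if_distrib if_distribR
        cong: if_cong intro!: sum.cong arg_cong2[where f="(+)"])
  also have "\<dots> = (\<Sum>(J, K)\<in>splittings I. \<Sum>j\<in>UNIV. \<Sum>p\<in>{0,1}. pscale ((- 1) ^ (p * a)) (pscale (\<phi> (dpow J) $ j * of_nat (K $ j + 1))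
     (if (J $ 1 + unitv j $ 1) mod 2 = p then tensor x (dpow (K + unitv j)) else 0)))"
    by (simp add: sum.distrib case_prod_unfold)
  also have "\<dots> = (\<Sum>(J, K)\<in>splittings I. \<Sum>j\<in>UNIV. pscale (\<phi> (dpow J) $ j * of_nat (K $ j + 1) * (- 1) ^ ((J $ 1 + unitv j $ 1) * a)) (tensor x (dpow (K + unitv j))))"
  proof (intro sum.cong refl, clarify, intro sum.cong refl)
    fix J K :: "nat^3" and j :: 3
    let ?m = "J $ 1 + unitv j $ 1"
    have sg: "(-1 :: complex) ^ (?m * a) = (-1) ^ ((?m mod 2) * a)"
      by (metis (no_types, opaque_lifting) even_mult_iff even_mod_2_iff neg_one_even_power neg_one_odd_power)
    have "?m mod 2 = 0 \<or> ?m mod 2 = 1" by presburger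
    then show "(\<Sum>p\<in>{0,1}. pscale ((- 1) ^ (p * a)) (pscale (\<phi> (dpow J) $ j * of_nat (K $ j + 1))
     (if ?m mod 2 = p then tensor x (dpow (K + unitv j)) else 0))) = 
      pscale (\<phi> (dpow J) $ j * of_nat (K $ j + 1) * (- 1) ^ (?m * a)) (tensor x (dpow (K + unitv j)))"
      unfolding sg by (elim disjE) (simp_all add: mult_ac)
  qed
  finally show ?thesis .
qed

lemma splittings_assoc1:
  "(\<Sum>(I', C)\<in>splittings I. \<Sum>(J, K)\<in>splittings I'. f J K C) = (\<Sum>(J, M)\<in>splittings I. \<Sum>(K, C)\<in>splittings M. f J K C)"
  by (simp add: sum.Sigma case_prod_unfold)
     (rule sum.reindex_bij_witness[where i="\<lambda>((J,M),(K,C)). ((J+K,C),(J,K))" and j="\<lambda>((I',C),(J,K)). ((J,K+C),(K,C))"],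
      auto simp: splittings_def add.assoc)

lemma splittings_assoc2:
  "(\<Sum>(A, I')\<in>splittings I. \<Sum>(J, K)\<in>splittings I'. f J K A) = (\<Sum>(J, M)\<in>splittings I. \<Sum>(A, K)\<in>splittings M. f J K A)"
  by (simp add: sum.Sigma case_prod_unfold)
     (rule sum.reindex_bij_witness[where i="\<lambda>((J,M),(A,K)). ((A,J+K),(J,K))" and j="\<lambda>((A,I'),(J,K)). ((J,A+K),(A,K))"],
      auto simp: splittings_def add_ac)

lemma u_sub: "A $ j \<noteq> 0 \<Longrightarrow> A - unitv j + unitv j = A"
  by (auto simp: vec_eq_iff axis_def)

lemma shiftA: "A + B = M + unitv j \<Longrightarrow> A $ j \<noteq> 0 \<Longrightarrow> A - unitv j + B = M"
proof -
  assume *: "A + B = M + unitv j" "A $ j \<noteq> 0"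
  have "A $ i + B $ i = M $ i + unitv j $ i" for i
    using arg_cong[OF *(1), of "\<lambda>v. v $ i"] by simp
  then have "A $ i - unitv j $ i + B $ i = M $ i" for i
    using *(2) using \<open>\<And>i. A $ i + B $ i = M $ i + unitv j $ i\<close>[of i] by (cases "i = j") (simp_all add: axis_def)
  then show "A - unitv j + B = M" by (simp add: vec_eq_iff)
qed

lemma shiftB: "K + unitv j + C = K + C + unitv j"
  by (simp add: add_ac)

lemma splittings_shift1:
  fixes F :: "nat^3 \<Rightarrow> nat^3 \<Rightarrow> (midx \<times> midx \<Rightarrow>\<^sub>0 complex)"
  shows "(\<Sum>(K, C)\<in>splittings M. pscale (of_nat (K $ j + 1)) (F (K + unitv j) C)) = (\<Sum>(A, B)\<in>splittings (M + unitv j). pscale (of_nat (A $ j)) (F A B))"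
proof -
  have "(\<Sum>(A, B)\<in>splittings (M + unitv j). pscale (of_nat (A $ j)) (F A B)) = (\<Sum>(A, B)\<in>{(A,B)\<in>splittings (M + unitv j). A $ j \<noteq> 0}. pscale (of_nat (A $ j)) (F A B))"
    by (rule sum.mono_neutral_right) auto
  also have "\<dots> = (\<Sum>(K, C)\<in>splittings M. pscale (of_nat (K $ j + 1)) (F (K + unitv j) C))"
    by (rule sum.reindex_bij_witness[where i="\<lambda>(K,C). (K + unitv j, C)" and j="\<lambda>(A,B). (A - unitv j, B)"])
       (auto simp: splittings_def u_sub shiftA shiftB simp del: One_nat_def)
  finally show ?thesis ..
qed

lemma splittings_shift2:
  fixes F :: "nat^3 \<Rightarrow> nat^3 \<Rightarrow> (midx \<times> midx \<Rightarrow>\<^sub>0 complex)"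
  shows "(\<Sum>(C, K)\<in>splittings M. pscale (of_nat (K $ j + 1)) (F C (K + unitv j))) = (\<Sum>(A, B)\<in>splittings (M + unitv j). pscale (of_nat (B $ j)) (F A B))"
proof -
  have sw: "(\<Sum>(A,B)\<in>splittings N. g A B) = (\<Sum>(B,A)\<in>splittings N. g A B)" for N and g :: "nat^3 \<Rightarrow> nat^3 \<Rightarrow> (midx \<times> midx \<Rightarrow>\<^sub>0 complex)"
    by (rule sum.reindex_bij_witness[where i="\<lambda>(K,C). (C, K)" and j="\<lambda>(K,C). (C, K)"]) (auto simp: splittings_def add_ac)
  show ?thesis
    using splittings_shift1[where F="\<lambda>A B. F B A"] by (subst (1 2) sw) simp
qed

lemma comult_shift:
  assumes I: "valid I" and JM: "(J, M) \<in> splittings I"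
  shows "pscale (of_nat (M $ j + 1)) (comult (dpow (M + unitv j))) =
    (\<Sum>(K, C)\<in>splittings M. pscale (of_nat (K $ j + 1)) (tensor (dpow (K + unitv j)) (dpow C))) +
    (\<Sum>(C, K)\<in>splittings M. pscale (of_nat (K $ j + 1)) (pscale ((- 1) ^ ((J $ 1 + unitv j $ 1) * C $ 1)) (tensor (dpow C) (dpow (K + unitv j)))))"
    (is "?l = ?r1 + ?r2")
proof -
  have "?r1 + ?r2 = (\<Sum>(A,B)\<in>splittings (M + unitv j). pscale (of_nat (A $ j) + of_nat (B $ j) * (- 1) ^ ((J $ 1 + unitv j $ 1) * A $ 1)) (tensor (dpow A) (dpow B)))"
    unfolding splittings_shift1[where F="\<lambda>A B. tensor (dpow A) (dpow B)"]
      splittings_shift2[where F="\<lambda>A B. pscale ((- 1) ^ ((J $ 1 + unitv j $ 1) * A $ 1)) (tensor (dpow A) (dpow B))"]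
    by (auto simp: pscale.scale_left_distrib sum.distrib case_prod_unfold)
  also have "\<dots> = (\<Sum>(A,B)\<in>splittings (M + unitv j). pscale (if valid (M + unitv j) then of_nat (M $ j + 1) else 0) (tensor (dpow A) (dpow B)))"
  proof (intro sum.cong refl, clarify)
    fix A B assume "(A, B) \<in> splittings (M + unitv j)"
    then have AB: "A + B = M + unitv j" by (simp add: splittings_def)
    show "pscale (of_nat (A $ j) + of_nat (B $ j) * (- 1) ^ ((J $ 1 + unitv j $ 1) * A $ 1)) (tensor (dpow A) (dpow B)) =
      pscale (if valid (M + unitv j) then of_nat (M $ j + 1) else 0) (tensor (dpow A) (dpow B))"
    proof (cases "valid A \<and> valid B")
      case True
      then have le: "A $ 1 \<le> 1" "B $ 1 \<le> 1" by (auto simp: valid_def)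
      have IJ: "J $ 1 + M $ 1 = I $ 1" "I $ 1 \<le> 1" using I JM by (auto simp: valid_def splittings_def)
      have abj: "A $ j + B $ j = M $ j + 1" using arg_cong[OF AB, of "\<lambda>v. v $ j"] by (simp add: axis_def)
      have ab1: "A $ 1 + B $ 1 = M $ 1 + unitv j $ 1" using arg_cong[OF AB, of "\<lambda>v. v $ 1"] by simp
      have nz: "M + unitv j \<noteq> 0" by (auto simp: vec_eq_iff axis_def)
      show ?thesis
      proof (cases "j = 1")
        case False
        then have "unitv j $ 1 = 0" by (simp add: axis_def)
        moreover from this have "J $ 1 * A $ 1 = 0" using ab1 IJ by auto
        moreover have "valid (M + unitv j)" using nz IJ calculation by (auto simp: valid_def)
        moreover have "(of_nat (A $ j) + of_nat (B $ j) :: complex) = of_nat (M $ j + 1)"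
          using abj by (simp only: flip: of_nat_add)
        ultimately show ?thesis by (auto simp del: One_nat_def)
      next
        case True
        then have u1: "unitv j $ 1 = 1" by (simp add: axis_def)
        show ?thesis
        proof (cases "M $ 1 = 0")
          case True
          then have "valid (M + unitv j)" using nz u1 by (auto simp: valid_def)
          moreover have "A $ 1 = 0 \<or> (A $ 1 = 1 \<and> B $ 1 = 0)" using le ab1 u1 True by auto
          ultimately show ?thesis using abj \<open>j = 1\<close> True by auto
        next
          case False
          then have "\<not> valid (M + unitv j)" using u1 by (auto simp: valid_def)
          moreover have "A $ 1 = 1" "B $ 1 = 1" "J $ 1 = 0" using le ab1 u1 False IJ by auto
          ultimately show ?thesis using \<open>j = 1\<close> by (simp add: axis_def)
        qed
      qed
    qed (auto simp: dpow_def)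
  qed
  also have "\<dots> = ?l"
  proof (cases "valid (M + unitv j)")
    case True
    then show ?thesis by (simp add: comult_e pscale.scale_sum_right case_prod_unfold)
  qed (simp add: dpow_def comult_def)
  finally show ?thesis ..
qed

lemma comult_lin: "Vector_Spaces.linear pscale pscale comult"
  unfolding comult_def by (rule linext_linear)
lemma coder_sum_lin: "Vector_Spaces.linear pscale pscale (coder_sum f)"
  unfolding coder_sum_def by (rule linext_linear)

lemma coder_e:
  assumes I: "valid I" and \<phi>0: "\<phi> 0 = 0"
  shows "comult (coext_formula \<phi> (dpow I)) = coder_sum (coext_formula \<phi>) (comult (dpow I))"
proof -
  interpret c: Vector_Spaces.linear pscale pscale comult by (rule comult_lin)
  interpret cs: Vector_Spaces.linear pscale pscale "coder_sum h" for h by (rule coder_sum_lin)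
  let ?p = "\<lambda>J j. \<phi> (dpow J) $ j"
  have "comult (coext_formula \<phi> (dpow I)) = (\<Sum>(J, M)\<in>splittings I. \<Sum>j\<in>UNIV. pscale (?p J j) (pscale (of_nat (M $ j + 1)) (comult (dpow (M + unitv j)))))"
    using I by (simp add: ext_e c.sum c.scale case_prod_unfold)
  also have "\<dots> = (\<Sum>(J, M)\<in>splittings I. \<Sum>j\<in>UNIV. pscale (?p J j) (
    (\<Sum>(K, C)\<in>splittings M. pscale (of_nat (K $ j + 1)) (tensor (dpow (K + unitv j)) (dpow C))) +
    (\<Sum>(C, K)\<in>splittings M. pscale (of_nat (K $ j + 1)) (pscale ((- 1) ^ ((J $ 1 + unitv j $ 1) * C $ 1)) (tensor (dpow C) (dpow (K + unitv j)))))))"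
    using I by (intro sum.cong refl, clarify, intro sum.cong refl) (simp only: comult_shift)
  also have "\<dots> = (\<Sum>(J, M)\<in>splittings I. \<Sum>(K, C)\<in>splittings M. \<Sum>j\<in>UNIV. pscale (?p J j * of_nat (K $ j + 1)) (tensor (dpow (K + unitv j)) (dpow C))) +
     (\<Sum>(J, M)\<in>splittings I. \<Sum>(C, K)\<in>splittings M. \<Sum>j\<in>UNIV. pscale (?p J j * of_nat (K $ j + 1) * (- 1) ^ ((J $ 1 + unitv j $ 1) * C $ 1)) (tensor (dpow C) (dpow (K + unitv j))))"
  proof -
    have 1: "(\<Sum>j\<in>UNIV. pscale (a j) ((\<Sum>q\<in>S. pscale (b j q) (f j q)) + (\<Sum>q\<in>S. pscale (b' j q) (pscale (c j q) (f' j q))))) =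
      (\<Sum>q\<in>S. \<Sum>j\<in>UNIV. pscale (a j * b j q) (f j q)) + (\<Sum>q\<in>S. \<Sum>j\<in>UNIV. pscale (a j * b' j q * c j q) (f' j q))"
      for a :: "3 \<Rightarrow> complex" and b c b' and f f' :: "3 \<Rightarrow> _ \<Rightarrow> (midx \<times> midx \<Rightarrow>\<^sub>0 complex)" and S :: "((nat^3) \<times> (nat^3)) set"
      unfolding sum.swap[of _ "UNIV :: 3 set" S]
      by (simp add: pscale.scale_right_distrib pscale.scale_sum_right sum.distrib mult.assoc)
    show ?thesis
      unfolding case_prod_unfold 1 sum.distrib ..
  qed
  also have "\<dots> = (\<Sum>(I', C)\<in>splittings I. \<Sum>(J, K)\<in>splittings I'. \<Sum>j\<in>UNIV. pscale (?p J j * of_nat (K $ j + 1)) (tensor (dpow (K + unitv j)) (dpow C))) +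
     (\<Sum>(C, I')\<in>splittings I. \<Sum>(J, K)\<in>splittings I'. \<Sum>j\<in>UNIV. pscale (?p J j * of_nat (K $ j + 1) * (- 1) ^ ((J $ 1 + unitv j $ 1) * C $ 1)) (tensor (dpow C) (dpow (K + unitv j))))"
    by (intro arg_cong2[where f="(+)"] splittings_assoc1[symmetric] splittings_assoc2[symmetric])
  also have "\<dots> = (\<Sum>(A,B)\<in>splittings I. tensor (coext_formula \<phi> (dpow A)) (dpow B) +
     (\<Sum>p\<in>{0,1}. pscale ((- 1) ^ (p * A $ 1)) (tensor (dpow A) (hpart p (coext_formula \<phi>) (dpow B)))))"
    unfolding case_prod_unfold sum.distrib
  proof (intro arg_cong2[where f="(+)"])
    show "(\<Sum>p\<in>splittings I. \<Sum>q\<in>splittings (fst p). \<Sum>j\<in>UNIV. pscale (?p (fst q) j * of_nat (snd q $ j + 1)) (tensor (dpow (snd q + unitv j)) (dpow (snd p)))) =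
      (\<Sum>p\<in>splittings I. tensor (coext_formula \<phi> (dpow (fst p))) (dpow (snd p)))"
    proof (rule sum.cong[OF refl])
      fix p assume "p \<in> splittings I"
      then have "fst p $ 1 \<le> 1" using I by (auto simp: splittings_def valid_def)
      then show "(\<Sum>q\<in>splittings (fst p). \<Sum>j\<in>UNIV. pscale (?p (fst q) j * of_nat (snd q $ j + 1)) (tensor (dpow (snd q + unitv j)) (dpow (snd p)))) =
        tensor (coext_formula \<phi> (dpow (fst p))) (dpow (snd p))"
        using \<phi>0 by (simp add: ext_e' tensor_sum1 tensor_scale1 case_prod_unfold)
    qed
    show "(\<Sum>p\<in>splittings I. \<Sum>q\<in>splittings (snd p). \<Sum>j\<in>UNIV. pscale (?p (fst q) j * of_nat (snd q $ j + 1) * (- 1) ^ ((fst q $ 1 + unitv j $ 1) * fst p $ 1)) (tensor (dpow (fst p)) (dpow (snd q + unitv j)))) =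
      (\<Sum>p\<in>splittings I. \<Sum>r\<in>{0,1}. pscale ((- 1) ^ (r * fst p $ 1)) (tensor (dpow (fst p)) (hpart r (coext_formula \<phi>) (dpow (snd p)))))"
    proof (rule sum.cong[OF refl])
      fix p assume p: "p \<in> splittings I"
      interpret h: Vector_Spaces.linear pscale pscale "hpart r (coext_formula \<phi>)" for r by (rule hpart_lin[OF ext_lin])
      show "(\<Sum>q\<in>splittings (snd p). \<Sum>j\<in>UNIV. pscale (?p (fst q) j * of_nat (snd q $ j + 1) * (- 1) ^ ((fst q $ 1 + unitv j $ 1) * fst p $ 1)) (tensor (dpow (fst p)) (dpow (snd q + unitv j)))) =
        (\<Sum>r\<in>{0,1}. pscale ((- 1) ^ (r * fst p $ 1)) (tensor (dpow (fst p)) (hpart r (coext_formula \<phi>) (dpow (snd p)))))"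
      proof (cases "valid (snd p)")
        case True
        then show ?thesis using ext_sign[where \<phi>=\<phi>, OF True \<phi>0, of "fst p $ 1" "dpow (fst p)"] by (simp only: case_prod_unfold)
      next
        case False
        then have "snd p = 0" using p I False by (auto simp: splittings_def valid_def)
        moreover have "splittings 0 = {(0, 0)}" by (auto simp: splittings_def vec_eq_iff)
        ultimately show ?thesis using \<phi>0 by (simp add: dpow_def valid_def h.zero)
      qed
    qed
  qed
  also have "\<dots> = coder_sum (coext_formula \<phi>) (comult (dpow I))"
    using I by (simp add: comult_e cs.sum coder_sum_tensor[OF ext_lin] case_prod_unfold)
  finally show ?thesis .
qed

lemma e0 [simp]: "dpow 0 = 0"
  by (simp add: dpow_def valid_def)

lemma total_add: "total (A + B) = total A + total B"
  by (simp add: total_def sum.distrib)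

lemma total_pos: "valid A \<Longrightarrow> total A > 0"
  by (auto simp: total_def valid_def vec_eq_iff intro!: sum_pos2)

lemma proj1_lin: "Vector_Spaces.linear pscale (*s) proj1"
  by unfold_locales (auto simp: proj1_def vec_eq_iff lookup_add algebra_simps)

lemma proj1_e: "proj1 (dpow (K + unitv j)) = (if K = 0 then axis j 1 else 0)"
proof -
  have "valid (unitv i)" for i by (auto simp: valid_def axis_def vec_eq_iff)
  moreover have "K + unitv j = unitv i \<longleftrightarrow> K = 0 \<and> j = i" for i :: 3
  proof
    assume *: "K + unitv j = unitv i"
    have "total (unitv k) = 1" for k by (simp add: total_def axis_def)
    then have "total K = 0" using arg_cong[OF *, of total] by (simp add: total_add)
    then have "K = 0" by (auto simp: total_def vec_eq_iff)
    then show "K = 0 \<and> j = i" using * by (auto simp: axis_eq_axis)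
  qed auto
  moreover have "mfact (unitv j) = 1"
    unfolding mfact_def by (intro prod.neutral) (simp add: axis_def)
  ultimately have "Poly_Mapping.lookup (dpow (K + unitv j)) (Midx (unitv i)) = (if K = 0 \<and> j = i then 1 else 0)" for i
    by (auto simp: dpow_def lookup_single when_def Midx_inj simp del: One_nat_def)
  then show ?thesis by (auto simp: proj1_def vec_eq_iff axis_def simp del: One_nat_def)
qed

lemma ext_coderivation:
  assumes \<phi>: "Vector_Spaces.linear pscale (*s) \<phi>"
  shows "coderivation (coext_formula \<phi>)" and "proj1 (coext_formula \<phi> x) = \<phi> x"
proof -
  interpret ph: Vector_Spaces.linear pscale "(*s)" \<phi> by fact
  interpret c: Vector_Spaces.linear pscale pscale comult by (rule comult_lin)
  interpret cs: Vector_Spaces.linear pscale pscale "coder_sum h" for h by (rule coder_sum_lin)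
  interpret ex: Vector_Spaces.linear pscale pscale "coext_formula \<phi>" by (rule ext_lin)
  interpret p: Vector_Spaces.linear pscale "(*s)" proj1 by (rule proj1_lin)
  have l1: "Vector_Spaces.linear pscale pscale (\<lambda>x. comult (coext_formula \<phi> x))"
    by (rule linear_PI) (simp_all add: ex.add ex.scale c.add c.scale)
  have l2: "Vector_Spaces.linear pscale pscale (\<lambda>x. coder_sum (coext_formula \<phi>) (comult x))"
    by (rule linear_PI) (simp_all add: cs.add cs.scale c.add c.scale)
  have l3: "Vector_Spaces.linear pscale (*s) (\<lambda>x. proj1 (coext_formula \<phi> x))"
    by unfold_locales (simp_all add: ex.add ex.scale p.add p.scale)
  have "comult (coext_formula \<phi> x) = coder_sum (coext_formula \<phi>) (comult x)" for x
  proof (rule lin_eqI[OF l1 l2])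
    fix I
    show "comult (coext_formula \<phi> (Poly_Mapping.single I 1)) = coder_sum (coext_formula \<phi>) (comult (Poly_Mapping.single I 1))"
      unfolding wmon_def[symmetric] wmon_e by (simp add: c.scale cs.scale ex.scale coder_e ph.zero)
  qed
  then show "coderivation (coext_formula \<phi>)" by (simp add: coderivation_def ext_lin)
  show "proj1 (coext_formula \<phi> x) = \<phi> x"
  proof (rule lin_eqI[OF l3 \<phi>])
    fix I
    let ?I = "expo I"
    have "proj1 (coext_formula \<phi> (dpow ?I)) = (\<Sum>(J, K)\<in>splittings ?I. \<Sum>j\<in>UNIV. (\<phi> (dpow J) $ j * of_nat (K $ j + 1)) *s (if K = 0 then axis j 1 else 0))"
      by (simp add: ext_e p.sum p.scale proj1_e case_prod_unfold del: One_nat_def)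
    also have "\<dots> = (\<Sum>(J, K)\<in>{(?I, 0)}. \<Sum>j\<in>UNIV. (\<phi> (dpow J) $ j * of_nat (K $ j + 1)) *s (if K = 0 then axis j 1 else 0))"
    proof (rule sum.mono_neutral_right[OF finite_splittings])
      show "{(?I, 0)} \<subseteq> splittings ?I" by (simp add: splittings_def)
      show "\<forall>p\<in>splittings ?I - {(?I, 0)}. (case p of (J, K) \<Rightarrow> \<Sum>j\<in>UNIV. (\<phi> (dpow J) $ j * of_nat (K $ j + 1)) *s (if K = 0 then axis j 1 else 0)) = 0"
      proof
        fix p assume p: "p \<in> splittings ?I - {(?I, 0)}"
        obtain J K where JK: "p = (J, K)" by (cases p)
        have "K \<noteq> 0" using p by (auto simp: JK splittings_def)
        then show "(case p of (J, K) \<Rightarrow> \<Sum>j\<in>UNIV. (\<phi> (dpow J) $ j * of_nat (K $ j + 1)) *s (if K = 0 then axis j 1 else 0)) = 0"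
          by (simp add: JK)
      qed
    qed
    also have "\<dots> = (\<Sum>j\<in>UNIV. (\<phi> (dpow ?I) $ j) *s axis j 1)" by simp
    also have "\<dots> = \<phi> (dpow ?I)" by (rule basis_expansion)
    finally show "proj1 (coext_formula \<phi> (Poly_Mapping.single I 1)) = \<phi> (Poly_Mapping.single I 1)"
      unfolding wmon_def[symmetric] wmon_e by (simp add: ex.scale p.scale ph.scale)
  qed
qed

lemma comult_lookup:
  assumes "valid A" "valid B" "valid (A + B)"
  shows "Poly_Mapping.lookup (comult x) (Midx A, Midx B) =
    of_nat (mbinom (A + B) A) * Poly_Mapping.lookup x (Midx (A + B))"
proof -
  have *: "Poly_Mapping.lookup (\<Sum>(J, K) | expo J + expo K = expo I. pscale (of_nat (mbinom (expo I) (expo J))) (tensor (wmon J) (wmon K))) (Midx A, Midx B)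
    = (if I = Midx (A + B) then of_nat (mbinom (A + B) A) else 0)" for I
  proof -
    have "Poly_Mapping.lookup (\<Sum>(J, K) | expo J + expo K = expo I. pscale (of_nat (mbinom (expo I) (expo J))) (tensor (wmon J) (wmon K))) (Midx A, Midx B)
      = (\<Sum>p \<in> {(J, K). expo J + expo K = expo I}. if p = (Midx A, Midx B) then of_nat (mbinom (A + B) A) else 0)"
      unfolding lookup_sum
    proof (intro sum.cong refl)
      fix p assume p: "p \<in> {(J, K). expo J + expo K = expo I}"
      obtain J K where JK: "p = (J, K)" by (cases p)
      have "expo I = A + B" if "J = Midx A" "K = Midx B" using p that assms by (simp add: JK)
      then show "Poly_Mapping.lookup (case p of (J, K) \<Rightarrow> pscale (of_nat (mbinom (expo I) (expo J))) (tensor (wmon J) (wmon K))) (Midx A, Midx B)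
        = (if p = (Midx A, Midx B) then of_nat (mbinom (A + B) A) else 0)"
        using assms by (auto simp: JK wmon_def lookup_single when_def)
    qed
    also have "\<dots> = (if (Midx A, Midx B) \<in> {(J, K). expo J + expo K = expo I} then of_nat (mbinom (A + B) A) else 0)"
      by (rule sum.delta) simp
    also have "(Midx A, Midx B) \<in> {(J, K). expo J + expo K = expo I} \<longleftrightarrow> I = Midx (A + B)"
      using assms by (simp add: eq_commute[of I] Midx_eq_iff)
    finally show ?thesis .
  qed
  show ?thesis
    unfolding comult_def lookup_linext * by (auto simp: if_distrib sum.delta in_keys_iff cong: if_cong)
qed

lemma comult_kernel:
  assumes "comult x = 0" "proj1 x = 0"
  shows "x = 0"
proof (rule poly_mapping_eqI)
  fix I
  let ?I = "expo I"
  have v: "valid (unitv j)" for j by (auto simp: valid_def axis_def vec_eq_iff)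
  obtain j where j: "?I $ j \<noteq> 0"
    using valid_expo[of I] by (auto simp: valid_def vec_eq_iff)
  have I: "(?I - unitv j) + unitv j = ?I" using u_sub[OF j] .
  show "Poly_Mapping.lookup x I = Poly_Mapping.lookup 0 I"
  proof (cases "?I - unitv j = 0")
    case True
    then have "I = Midx (unitv j)" using I by (metis add_0 expo_inverse)
    then show ?thesis using arg_cong[OF assms(2), of "\<lambda>v. v $ j"] by (simp add: proj1_def)
  next
    case False
    have "(?I - unitv j) $ 1 \<le> 1" using valid_expo[of I] by (auto simp: valid_def)
    then have "valid (?I - unitv j)" using False by (simp add: valid_def)
    with v I have "of_nat (mbinom ?I (?I - unitv j)) * Poly_Mapping.lookup x I = 0"
      using comult_lookup[of "?I - unitv j" "unitv j" x] by (simp add: assms expo_inverse)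
    moreover have "mbinom ?I (?I - unitv j) \<noteq> 0" by (auto simp: mbinom_def)
    ultimately show ?thesis by simp
  qed
qed

lemma coderivation_unique:
  assumes "coderivation f" "coderivation g" "\<And>x. proj1 (f x) = proj1 (g x)"
  shows "f = g"
proof
  have lf: "Vector_Spaces.linear pscale pscale f" and lg: "Vector_Spaces.linear pscale pscale g"
    using assms by (simp_all add: coderivation_def)
  interpret f: Vector_Spaces.linear pscale pscale f by (rule lf)
  interpret g: Vector_Spaces.linear pscale pscale g by (rule lg)
  interpret c: Vector_Spaces.linear pscale pscale comult by (rule comult_lin)
  interpret cs: Vector_Spaces.linear pscale pscale "coder_sum h" for h by (rule coder_sum_lin)
  interpret p: Vector_Spaces.linear pscale "(*s)" proj1 by (rule proj1_lin)
  have eq: "f (dpow I) = g (dpow I)" if "valid I" for I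
    using that
  proof (induction "total I" arbitrary: I rule: less_induct)
    case less
    have "coder_sum f (tensor (dpow A) (dpow B)) = coder_sum g (tensor (dpow A) (dpow B))" if "(A, B) \<in> splittings I" for A B
    proof (cases "valid A \<and> valid B")
      case True
      then have "f (dpow A) = g (dpow A)" "f (dpow B) = g (dpow B)" using that total_pos[of A] total_pos[of B]
        by (auto simp: splittings_def total_add intro!: less.hyps)
      moreover have "f 0 = 0" "g 0 = 0" using lin0[OF lf] lin0[OF lg] by auto
      ultimately have "hpart p f (dpow B) = hpart p g (dpow B)" for p
        by (simp add: hpart_def par_proj_e)
      with \<open>f (dpow A) = g (dpow A)\<close> show ?thesis
        by (simp add: coder_sum_tensor[OF lf] coder_sum_tensor[OF lg])
    next
      case False
      then show ?thesis by (auto simp: dpow_def cs.zero)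
    qed
    then have "comult (f (dpow I)) = comult (g (dpow I))"
      using assms less.prems by (auto simp: coderivation_def comult_e cs.sum intro!: sum.cong)
    then have "f (dpow I) - g (dpow I) = 0" by (intro comult_kernel) (simp_all add: c.diff p.diff assms)
    then show ?case by simp
  qed
  fix x
  show "f x = g x"
  proof (rule lin_eqI[OF lf lg])
    fix I show "f (Poly_Mapping.single I 1) = g (Poly_Mapping.single I 1)"
      unfolding wmon_def[symmetric] wmon_e by (simp add: f.scale g.scale eq)
  qed
qed

lemma coext_eq:
  assumes "Vector_Spaces.linear pscale (*s) \<phi>"
  shows "coext \<phi> = coext_formula \<phi>"
  unfolding coext_def
  by (rule the_equality) (auto simp: ext_coderivation[OF assms] intro: coderivation_unique)


end

(*
  In divided powers w_I / I! a coderivation becomes a polynomial vector field in an odd variable t and even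
  variables y, z, and d_sharp becomes t E with E = y d/dy + (y + z) d/dz.  Split a cochain into its t-free
  components f_j and its t-components g_j.  D then acts by
    f_2 = y f_1,  f_3 = (y + z) f_1,  g_1 = E f_1,
    g_2 = E f_2 - f_2 - y g_1,  g_3 = E f_3 - f_3 - f_2 - (y + z) g_1
  (new components on the left, f_1 = 0 there).  On polynomials of degree n the operator E is n plus a nilpotent
  map, hence E - c is invertible for n different from c.  For a cocycle of degree n >= 2 solve E h = g_1; by the
  injectivity of E - 1 in degree n, f_2 = y h and f_3 = (y + z) h.  For n > 2 one can also invert E - 1 in
  degree n - 1, which makes g_2 and g_3 exact; the degrees 1 and 2 are finite linear algebra.
*)
theory Submission
  imports Defs
begin

section \<open>Multi-indices given by their entries, and sums over splittings\<close>

definition mi :: "nat \<Rightarrow> nat \<Rightarrow> nat \<Rightarrow> nat^3" where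
  "mi i a b = vector [i, a, b]"

lemma mi_nth [simp]: "mi i a b $ 1 = i" "mi i a b $ 2 = a" "mi i a b $ 3 = b"
  by (simp_all add: mi_def vector_3)

lemma mi_eq_iff [simp]: "mi i a b = mi i' a' b' \<longleftrightarrow> i = i' \<and> a = a' \<and> b = b'"
  by (auto simp: vec_eq_iff forall_3)

lemma mi_eq_0_iff [simp]: "mi i a b = 0 \<longleftrightarrow> i = 0 \<and> a = 0 \<and> b = 0"
  by (auto simp: vec_eq_iff forall_3)

lemma mi_add [simp]: "mi i a b + mi i' a' b' = mi (i + i') (a + a') (b + b')"
  by (auto simp: vec_eq_iff forall_3)

lemma dpow_mi_0 [simp]: "dpow (mi 0 0 0) = 0"
  by (simp add: dpow_def valid_def)

lemma mi_surj: "I = mi (I $ 1) (I $ 2) (I $ 3)"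
  by (auto simp: vec_eq_iff forall_3)

lemma unitv_mi: "unitv 1 = mi 1 0 0" "unitv 2 = mi 0 1 0" "unitv 3 = mi 0 0 1"
  by (auto simp: vec_eq_iff forall_3 axis_def)

lemma valid_mi [simp]: "valid (mi i a b) \<longleftrightarrow> i \<le> 1 \<and> (i \<noteq> 0 \<or> a \<noteq> 0 \<or> b \<noteq> 0)"
  by (auto simp: valid_def)

lemma total_mi [simp]: "total (mi i a b) = i + a + b"
  by (simp add: total_def sum_3)

lemma mfact_mi [simp]: "mfact (mi i a b) = fact i * fact a * fact b"
  unfolding mfact_def UNIV_3 by (simp add: algebra_simps)

lemma lookup_dpow:
  "valid M \<Longrightarrow> Poly_Mapping.lookup (dpow I) (Midx M) = (if I = M then 1 / of_nat (mfact M) else 0)"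
  by (auto simp: dpow_def lookup_single when_def Midx_inj)

text \<open>One part of a splitting determines the other, so at most one term survives. Subtraction
  on \<open>nat^3\<close> is truncated, and the componentwise inequality says when
  \<open>I - J0\<close> is a true complement.\<close>

lemma sum_splittings_fst:
  fixes g :: "nat^3 \<Rightarrow> nat^3 \<Rightarrow> 'b::comm_monoid_add"
  shows "(\<Sum>(J, K)\<in>splittings I. if J = J0 then g J K else 0) =
    (if \<forall>i. J0 $ i \<le> I $ i then g J0 (I - J0) else 0)"
proof -
  have "(\<Sum>(J, K)\<in>splittings I. if J = J0 then g J K else 0) =
    (\<Sum>p\<in>splittings I. if p = (J0, I - J0) then g J0 (I - J0) else 0)"
  proof (intro sum.cong refl, clarify)
    fix J K assume "(J, K) \<in> splittings I"
    then have "I $ i = J $ i + K $ i" for i by (auto simp: splittings_def)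
    then have "J = J0 \<Longrightarrow> K = I - J0" by (simp add: vec_eq_iff)
    then show "(if J = J0 then g J K else 0) = (if (J, K) = (J0, I - J0) then g J0 (I - J0) else 0)"
      by auto
  qed
  moreover have "(J0, I - J0) \<in> splittings I \<longleftrightarrow> (\<forall>i. J0 $ i \<le> I $ i)"
    unfolding splittings_def mem_Collect_eq case_prod_conv vec_eq_iff vector_add_component vector_minus_component
    by (intro all_cong1) linarith
  ultimately show ?thesis by (simp add: sum.delta)
qed

text \<open>Exchange the two parts of each splitting. This version serves \<open>d_sharp\<close>
  applied after a coderivation, where the support of \<open>d_sharp\<close> restricts the untouched
  part \<open>K\<close>.\<close>

lemma sum_splittings_snd:
  fixes g :: "nat^3 \<Rightarrow> nat^3 \<Rightarrow> 'b::comm_monoid_add"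
  shows "(\<Sum>(J, K)\<in>splittings I. if K = K0 then g J K else 0) =
    (if \<forall>i. K0 $ i \<le> I $ i then g (I - K0) K0 else 0)"
proof -
  have "(\<Sum>(J, K)\<in>splittings I. if K = K0 then g J K else 0) =
    (\<Sum>(K, J)\<in>splittings I. if K = K0 then g J K else 0)"
    by (rule sum.reindex_bij_witness[where i=prod.swap and j=prod.swap])
      (auto simp: splittings_def add.commute)
  then show ?thesis
    unfolding sum_splittings_fst[where g="\<lambda>K J. g J K"] .
qed

section \<open>Linear cochains and their values on divided powers\<close>

abbreviation "cochain_linear \<equiv> Vector_Spaces.linear (pscale :: complex \<Rightarrow> SW \<Rightarrow> SW) ((*s) :: complex \<Rightarrow> W \<Rightarrow> W)"

lemma cochain_linearI:
  assumes "\<And>x y. f (x + y) = f x + f y" "\<And>c x. f (pscale c x) = c *s f x"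
  shows "cochain_linear f"
  using assms by unfold_locales auto

lemma phi_linear: "cochain_linear (phi I j)"
  by (cases I, rule cochain_linearI)
    (simp_all add: phi_def Let_def lookup_add vec_eq_iff algebra_simps)

text \<open>The factor \<open>I!\<close> in \<open>phi\<close> cancels the denominator in
  \<open>dpow\<close>: the cochains \<open>phi\<close> are dual to the divided powers, and no
  factorials remain in later formulas.\<close>

lemma phi_dpow:
  assumes "i \<le> 1" "i \<noteq> 0 \<or> a \<noteq> 0 \<or> b \<noteq> 0"
  shows "phi (i, a, b) j (dpow I) = (if I = mi i a b then axis j 1 else 0)"
  using assms by (simp add: phi_def Let_def lookup_dpow flip: mi_def del: mfact_mi)

lemma cochain_linear_add: "cochain_linear f \<Longrightarrow> cochain_linear g \<Longrightarrow> cochain_linear (f + g)"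
  unfolding Vector_Spaces.linear_iff by (simp add: vec_eq_iff algebra_simps)

lemma d_sharp_linear: "cochain_linear d_sharp"
  unfolding d_sharp_def by (intro cochain_linear_add phi_linear)

lemma d_sharp_dpow:
  "d_sharp (dpow I) = (if I = mi 1 1 0 then axis 2 1 + axis 3 1 else 0) + (if I = mi 1 0 1 then axis 3 1 else 0)"
  by (simp add: d_sharp_def phi_dpow del: One_nat_def)

section \<open>Coefficient functions and the two composites with \<open>d_sharp\<close>\<close>

lemma mi_diff [simp]: "mi i a b - mi i' a' b' = mi (i - i') (a - a') (b - b')"
  by (auto simp: vec_eq_iff forall_3)

definition coef :: "(SW \<Rightarrow> W) \<Rightarrow> nat \<Rightarrow> 3 \<Rightarrow> nat \<Rightarrow> nat \<Rightarrow> complex" where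
  "coef \<phi> i j a b = \<phi> (dpow (mi i a b)) $ j"

text \<open>On polynomials this is multiplication by \<open>y\<close>; likewise
  \<open>shift_z\<close> is multiplication by \<open>z\<close>.\<close>

definition shift_y :: "(nat \<Rightarrow> nat \<Rightarrow> complex) \<Rightarrow> nat \<Rightarrow> nat \<Rightarrow> complex" where
  "shift_y F a b = (if a = 0 then 0 else F (a - 1) b)"

definition shift_z :: "(nat \<Rightarrow> nat \<Rightarrow> complex) \<Rightarrow> nat \<Rightarrow> nat \<Rightarrow> complex" where
  "shift_z F a b = (if b = 0 then 0 else F a (b - 1))"

text \<open>\<open>F a b\<close> is the coefficient of \<open>y^a z^b\<close>, and the operator is \<open>y \<partial>/\<partial>y + (y + z) \<partial>/\<partial>z\<close>.\<close>

definition jordan_derivation :: "(nat \<Rightarrow> nat \<Rightarrow> complex) \<Rightarrow> nat \<Rightarrow> nat \<Rightarrow> complex" where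
  "jordan_derivation F a b = of_nat (a + b) * F a b + (if a = 0 then 0 else of_nat (b + 1) * F (a - 1) (b + 1))"

text \<open>Only \<open>mi 1 1 0\<close> and \<open>mi 1 0 1\<close> can be split off, which uses up
  the odd index. This map is the transpose of t E: evaluating a cochain on the result produces
  \<open>jordan_derivation\<close> of its t-free coefficients.\<close>

lemma coext_d_sharp_dpow:
  assumes "i \<le> 1"
  shows "coext_formula d_sharp (dpow (mi i a b)) =
    (if i = 1 then pscale (of_nat (a + b)) (dpow (mi 0 a b)) +
       (if a = 0 then 0 else pscale (of_nat (b + 1)) (dpow (mi 0 (a - 1) (b + 1)))) else 0)"
proof -
  have *: "(\<Sum>j\<in>UNIV. pscale (d_sharp (dpow J) $ j * of_nat (K $ j + 1)) (dpow (K + unitv j))) =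
    (if J = mi 1 1 0 then pscale (of_nat (K $ 2 + 1)) (dpow (K + unitv 2)) + pscale (of_nat (K $ 3 + 1)) (dpow (K + unitv 3)) else 0) +
    (if J = mi 1 0 1 then pscale (of_nat (K $ 3 + 1)) (dpow (K + unitv 3)) else 0)" for J K
    by (simp add: sum_3 d_sharp_dpow axis_def del: One_nat_def)
  have "coext_formula d_sharp (dpow (mi i a b)) = (\<Sum>(J, K)\<in>splittings (mi i a b).
      if J = mi 1 1 0 then pscale (of_nat (K $ 2 + 1)) (dpow (K + unitv 2)) + pscale (of_nat (K $ 3 + 1)) (dpow (K + unitv 3)) else 0) +
    (\<Sum>(J, K)\<in>splittings (mi i a b). if J = mi 1 0 1 then pscale (of_nat (K $ 3 + 1)) (dpow (K + unitv 3)) else 0)"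
    using assms by (subst ext_e') (simp_all only: * lin0[OF d_sharp_linear] mi_nth case_prod_unfold sum.distrib)
  then show ?thesis
    using assms unfolding sum_splittings_fst unitv_mi
    by (cases a; cases b) (auto simp: forall_3 lookup_add algebra_simps intro!: poly_mapping_eqI)
qed

text \<open>A term survives only if \<open>K + unitv j\<close> is \<open>mi 1 1 0\<close> or
  \<open>mi 1 0 1\<close>, which leaves four pairs of \<open>K\<close> and \<open>j\<close>. Those
  with \<open>j = 1\<close> give the shifts; those with \<open>K = mi 1 0 0\<close> give the t-free
  components 2 and 3.\<close>

lemma d_sharp_coext_dpow:
  assumes \<phi>: "cochain_linear \<phi>" and "i \<le> 1"
  shows "d_sharp (coext_formula \<phi> (dpow (mi i a b))) =
    (shift_y (coef \<phi> i 1) a b + (if i = 1 then coef \<phi> 0 2 a b else 0)) *s (axis 2 1 + axis 3 1) +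
    (shift_z (coef \<phi> i 1) a b + (if i = 1 then coef \<phi> 0 3 a b else 0)) *s axis 3 1"
proof -
  interpret d: Vector_Spaces.linear pscale "(*s)" d_sharp by (rule d_sharp_linear)
  have *: "(\<Sum>j\<in>UNIV. (\<phi> (dpow J) $ j * of_nat (K $ j + 1)) *s d_sharp (dpow (K + unitv j))) =
    (if K = mi 0 1 0 then \<phi> (dpow J) $ 1 *s (axis 2 1 + axis 3 1) else 0) +
    (if K = mi 1 0 0 then \<phi> (dpow J) $ 2 *s (axis 2 1 + axis 3 1) else 0) +
    (if K = mi 0 0 1 then \<phi> (dpow J) $ 1 *s axis 3 1 else 0) +
    (if K = mi 1 0 0 then \<phi> (dpow J) $ 3 *s axis 3 1 else 0)" for J K
  proof -
    obtain k1 k2 k3 where K: "K = mi k1 k2 k3" by (metis mi_surj)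
    show ?thesis unfolding K by (auto simp: sum_3 d_sharp_dpow unitv_mi simp del: One_nat_def)
  qed
  have "d_sharp (coext_formula \<phi> (dpow (mi i a b))) =
    (\<Sum>(J, K)\<in>splittings (mi i a b). if K = mi 0 1 0 then \<phi> (dpow J) $ 1 *s (axis 2 1 + axis 3 1) else 0) +
    (\<Sum>(J, K)\<in>splittings (mi i a b). if K = mi 1 0 0 then \<phi> (dpow J) $ 2 *s (axis 2 1 + axis 3 1) else 0) +
    (\<Sum>(J, K)\<in>splittings (mi i a b). if K = mi 0 0 1 then \<phi> (dpow J) $ 1 *s axis 3 1 else 0) +
    (\<Sum>(J, K)\<in>splittings (mi i a b). if K = mi 1 0 0 then \<phi> (dpow J) $ 3 *s axis 3 1 else 0)"
    using assms by (subst ext_e') (simp_all only: * lin0[OF \<phi>] mi_nth case_prod_unfold sum.distrib d.sum d.scale)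
  also have "\<dots> = (shift_y (coef \<phi> i 1) a b + (if i = 1 then coef \<phi> 0 2 a b else 0)) *s (axis 2 1 + axis 3 1) +
    (shift_z (coef \<phi> i 1) a b + (if i = 1 then coef \<phi> 0 3 a b else 0)) *s axis 3 1"
    using \<open>i \<le> 1\<close> unfolding sum_splittings_snd
    by (auto simp: forall_3 shift_y_def shift_z_def coef_def vec_eq_iff algebra_simps simp del: One_nat_def)
  finally show ?thesis .
qed

section \<open>Parity components and the differential in coordinates\<close>

lemma parproj_sum: "parproj 0 x + parproj 1 x = x"
proof -
  interpret p: Vector_Spaces.linear pscale pscale "parproj q" for q by (rule parproj_lin)
  have "Vector_Spaces.linear pscale pscale (\<lambda>x. parproj 0 x + parproj 1 x)"
    by (rule linear_PI) (simp_all add: p.add p.scale pscale.scale_right_distrib add_ac)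
  moreover have "Vector_Spaces.linear pscale pscale (\<lambda>x :: SW. x)"
    by (rule linear_PI) simp_all
  moreover have "parproj 0 (Poly_Mapping.single I 1) + parproj 1 (Poly_Mapping.single I 1) = Poly_Mapping.single I 1" for I
    unfolding wmon_def[symmetric] parproj_def linext_wmon
    using valid_expo[of I] by (auto simp: par_def valid_def)
  ultimately show ?thesis by (rule lin_eqI)
qed

lemma hpart_sum:
  assumes "Vector_Spaces.linear pscale pscale f"
  shows "hpart 0 f x + hpart 1 f x = f x"
proof -
  interpret f: Vector_Spaces.linear pscale pscale f by fact
  have "hpart 0 f x + hpart 1 f x =
    (parproj 0 (f (parproj 0 x)) + parproj 1 (f (parproj 0 x))) + (parproj 0 (f (parproj 1 x)) + parproj 1 (f (parproj 1 x)))"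
    by (simp add: hpart_def algebra_simps)
  also have "\<dots> = f x"
    unfolding parproj_sum f.add[symmetric] ..
  finally show ?thesis .
qed

lemma hpart_dpow:
  assumes "Vector_Spaces.linear pscale pscale f" "I $ 1 \<le> 1"
  shows "hpart p f (dpow I) = parproj ((p + I $ 1) mod 2) (f (dpow I))"
proof -
  have "I $ 1 = 0 \<or> I $ 1 = 1" using assms(2) by auto
  moreover have "parproj q 0 = 0" for q by (rule lin0[OF parproj_lin])
  ultimately show ?thesis using lin0[OF assms(1)] by (auto simp: hpart_def par_proj_e)
qed

text \<open>Both monomials of \<open>d_sharp\<close> contain the odd generator, so
  \<open>d_sharp\<close> vanishes on the even part.\<close>

lemma d_sharp_parproj: "d_sharp (parproj p x) = (if p = 1 then d_sharp x else 0)"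
proof (rule lin_eqI)
  interpret d: Vector_Spaces.linear pscale "(*s)" d_sharp by (rule d_sharp_linear)
  interpret p: Vector_Spaces.linear pscale pscale "parproj q" for q by (rule parproj_lin)
  show "cochain_linear (\<lambda>x. d_sharp (parproj p x))"
    by (rule cochain_linearI) (simp_all add: p.add p.scale d.add d.scale)
  show "cochain_linear (\<lambda>x. if p = 1 then d_sharp x else 0)"
    by (rule cochain_linearI) (simp_all add: d.add d.scale)
  fix I
  show "d_sharp (parproj p (Poly_Mapping.single I 1)) = (if p = 1 then d_sharp (Poly_Mapping.single I 1) else 0)"
    unfolding wmon_def[symmetric] wmon_e
    by (auto simp: p.scale d.scale par_proj_e d_sharp_dpow d.zero simp del: One_nat_def)
qed

text \<open>The coderivation of \<open>d_sharp\<close> is odd, because it removes the odd generator.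
  In \<open>gcomm\<close> only the terms with \<open>q = 1\<close> remain.\<close>

lemma hpart_coext_d_sharp: "hpart p (coext_formula d_sharp) x = (if p = 1 then coext_formula d_sharp x else 0)"
  if "p < 2"
proof (rule lin_eqI[where f="hpart p (coext_formula d_sharp)" and g="\<lambda>x. if p = 1 then coext_formula d_sharp x else 0"])
  interpret h: Vector_Spaces.linear pscale pscale "hpart p (coext_formula d_sharp)" by (rule hpart_lin[OF ext_lin])
  interpret e: Vector_Spaces.linear pscale pscale "coext_formula d_sharp" by (rule ext_lin)
  interpret p: Vector_Spaces.linear pscale pscale "parproj q" for q by (rule parproj_lin)
  show "Vector_Spaces.linear pscale pscale (hpart p (coext_formula d_sharp))" by (rule hpart_lin[OF ext_lin])
  show "Vector_Spaces.linear pscale pscale (\<lambda>x. if p = 1 then coext_formula d_sharp x else 0)"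
    by (rule linear_PI) (simp_all add: e.add e.scale)
  fix I
  obtain i a b where I: "expo I = mi i a b" by (metis mi_surj)
  then have i: "i \<le> 1" using valid_expo[of I] by simp
  have "p = 0 \<or> p = 1" using that by auto
  then have "hpart p (coext_formula d_sharp) (dpow (mi i a b)) = (if p = 1 then coext_formula d_sharp (dpow (mi i a b)) else 0)"
    using i
    by (subst hpart_dpow[OF ext_lin]) (auto simp: coext_d_sharp_dpow p.add p.scale p.zero par_proj_e)
  then show "hpart p (coext_formula d_sharp) (Poly_Mapping.single I 1) = (if p = 1 then coext_formula d_sharp (Poly_Mapping.single I 1) else 0)"
    unfolding wmon_def[symmetric] wmon_e I by (simp add: h.scale e.scale del: mfact_mi)
qed

text \<open>Here \<open>\<phi>\<close> may have mixed parity: the sign in the commutator with an odd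
  map is -1 for its even part and +1 for its odd part. Applying \<open>proj1\<close> turns the outer
  coderivation of each composite back into its cochain.\<close>

lemma D_d_sharp_eq:
  assumes \<phi>: "cochain_linear \<phi>"
  shows "D d_sharp \<phi> x = \<phi> (coext_formula d_sharp x) -
    (d_sharp (hpart 0 (coext_formula \<phi>) x) - d_sharp (hpart 1 (coext_formula \<phi>) x))"
proof -
  interpret p: Vector_Spaces.linear pscale "(*s)" proj1 by (rule proj1_lin)
  interpret h: Vector_Spaces.linear pscale pscale "hpart p (coext_formula \<phi>)" for p by (rule hpart_lin[OF ext_lin])
  have "gcomm (coext_formula \<phi>) (coext_formula d_sharp) x =
    hpart 0 (coext_formula \<phi>) (coext_formula d_sharp x) + hpart 1 (coext_formula \<phi>) (coext_formula d_sharp x)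
     - (coext_formula d_sharp (hpart 0 (coext_formula \<phi>) x) - coext_formula d_sharp (hpart 1 (coext_formula \<phi>) x))"
    by (simp add: gcomm_def hpart_coext_d_sharp h.zero)
  then show ?thesis
    unfolding D_def bracket_def coext_eq[OF \<phi>] coext_eq[OF d_sharp_linear]
    by (simp only: p.diff hpart_sum[OF ext_lin] ext_coderivation(2)[OF \<phi>] ext_coderivation(2)[OF d_sharp_linear])
qed

lemma D_d_sharp_linear:
  assumes \<phi>: "cochain_linear \<phi>"
  shows "cochain_linear (D d_sharp \<phi>)"
proof -
  interpret h: Vector_Spaces.linear pscale pscale "hpart p (coext_formula \<phi>)" for p by (rule hpart_lin[OF ext_lin])
  interpret e: Vector_Spaces.linear pscale pscale "coext_formula d_sharp" by (rule ext_lin)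
  interpret d: Vector_Spaces.linear pscale "(*s)" d_sharp by (rule d_sharp_linear)
  interpret f: Vector_Spaces.linear pscale "(*s)" \<phi> by (rule \<phi>)
  show ?thesis
    by (rule cochain_linearI)
      (simp_all add: D_d_sharp_eq[OF \<phi>] h.add h.scale e.add e.scale d.add d.scale f.add f.scale vec_eq_iff algebra_simps)
qed

text \<open>Since \<open>d_sharp\<close> sees only odd outputs, the parity of the input selects the
  component of \<open>\<phi>\<close> that contributes: the odd one for \<open>i = 0\<close>, the
  even one for \<open>i = 1\<close>. The sign therefore depends on \<open>i\<close> alone.\<close>

lemma D_d_sharp_dpow:
  assumes \<phi>: "cochain_linear \<phi>" and i: "i \<le> 1"
  shows "D d_sharp \<phi> (dpow (mi i a b)) =
    \<phi> (coext_formula d_sharp (dpow (mi i a b))) + (- 1) ^ i *s d_sharp (coext_formula \<phi> (dpow (mi i a b)))"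
proof -
  have "i = 0 \<or> i = 1" using i by auto
  then show ?thesis
    by (auto simp: D_d_sharp_eq[OF \<phi>] hpart_dpow[OF ext_lin] d_sharp_parproj)
qed

text \<open>The two composites combined. Component 3 also receives the terms of component 2 coming
  from \<open>shift_y\<close> and \<open>coef \<phi> 0 2\<close>, because \<open>d_sharp\<close>
  sends \<open>mi 1 1 0\<close> to \<open>axis 2 1 + axis 3 1\<close>.\<close>

lemma coef_D:
  assumes \<phi>: "cochain_linear \<phi>"
  shows "coef (D d_sharp \<phi>) 0 1 a b = 0"
    "coef (D d_sharp \<phi>) 0 2 a b = shift_y (coef \<phi> 0 1) a b"
    "coef (D d_sharp \<phi>) 0 3 a b = shift_y (coef \<phi> 0 1) a b + shift_z (coef \<phi> 0 1) a b"
    "coef (D d_sharp \<phi>) 1 1 a b = jordan_derivation (coef \<phi> 0 1) a b"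
    "coef (D d_sharp \<phi>) 1 2 a b = jordan_derivation (coef \<phi> 0 2) a b - coef \<phi> 0 2 a b - shift_y (coef \<phi> 1 1) a b"
    "coef (D d_sharp \<phi>) 1 3 a b = jordan_derivation (coef \<phi> 0 3) a b - coef \<phi> 0 3 a b - coef \<phi> 0 2 a b
       - shift_y (coef \<phi> 1 1) a b - shift_z (coef \<phi> 1 1) a b"
proof -
  interpret f: Vector_Spaces.linear pscale "(*s)" \<phi> by (rule \<phi>)
  have 0: "D d_sharp \<phi> (dpow (mi 0 a b)) = 
    shift_y (coef \<phi> 0 1) a b *s (axis 2 1 + axis 3 1) + shift_z (coef \<phi> 0 1) a b *s axis 3 1"
    by (simp add: D_d_sharp_dpow[OF \<phi>] coext_d_sharp_dpow d_sharp_coext_dpow[OF \<phi>] f.zero)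
  have 1: "D d_sharp \<phi> (dpow (mi 1 a b)) = (\<chi> j. jordan_derivation (coef \<phi> 0 j) a b) -
    ((shift_y (coef \<phi> 1 1) a b + coef \<phi> 0 2 a b) *s (axis 2 1 + axis 3 1) +
     (shift_z (coef \<phi> 1 1) a b + coef \<phi> 0 3 a b) *s axis 3 1)"
    by (auto simp: D_d_sharp_dpow[OF \<phi>] coext_d_sharp_dpow d_sharp_coext_dpow[OF \<phi>] f.zero f.add f.scale
      vec_eq_iff jordan_derivation_def coef_def distrib_right simp del: One_nat_def)
  show "coef (D d_sharp \<phi>) 0 1 a b = 0"
    "coef (D d_sharp \<phi>) 0 2 a b = shift_y (coef \<phi> 0 1) a b"
    "coef (D d_sharp \<phi>) 0 3 a b = shift_y (coef \<phi> 0 1) a b + shift_z (coef \<phi> 0 1) a b"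
    by (simp_all add: coef_def[of "D d_sharp \<phi>"] 0 axis_def)
  show "coef (D d_sharp \<phi>) 1 1 a b = jordan_derivation (coef \<phi> 0 1) a b"
    "coef (D d_sharp \<phi>) 1 2 a b = jordan_derivation (coef \<phi> 0 2) a b - coef \<phi> 0 2 a b - shift_y (coef \<phi> 1 1) a b"
    "coef (D d_sharp \<phi>) 1 3 a b = jordan_derivation (coef \<phi> 0 3) a b - coef \<phi> 0 3 a b - coef \<phi> 0 2 a b
       - shift_y (coef \<phi> 1 1) a b - shift_z (coef \<phi> 1 1) a b"
    by (simp_all add: coef_def[of "D d_sharp \<phi>"] 1 axis_def algebra_simps del: One_nat_def)
qed

section \<open>Cochains determined by, and built from, their coefficients\<close>

lemma coef_diff [simp]: "coef (\<phi> - \<psi>) i j a b = coef \<phi> i j a b - coef \<psi> i j a b"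
  by (simp add: coef_def)

lemma coef_add [simp]: "coef (\<phi> + \<psi>) i j a b = coef \<phi> i j a b + coef \<psi> i j a b"
  by (simp add: coef_def)

lemma coef_zero [simp]: "coef 0 i j a b = 0"
  by (simp add: coef_def)

lemma coef_phi:
  assumes "i \<le> 1" "i \<noteq> 0 \<or> a \<noteq> 0 \<or> b \<noteq> 0"
  shows "coef (phi (i, a, b) j) i' j' a' b' = (if i' = i \<and> a' = a \<and> b' = b \<and> j' = j then 1 else 0)"
  using assms by (simp add: coef_def phi_dpow axis_def)

lemma cochain_linear_diff: "cochain_linear f \<Longrightarrow> cochain_linear g \<Longrightarrow> cochain_linear (f - g)"
  unfolding Vector_Spaces.linear_iff by (simp add: vec_eq_iff algebra_simps)

lemma cochain_linear_zero: "cochain_linear 0"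
  by (rule cochain_linearI) simp_all

lemma coef_ext:
  assumes \<phi>: "cochain_linear \<phi>" and \<psi>: "cochain_linear \<psi>"
    and eq: "\<And>i j a b. i \<le> 1 \<Longrightarrow> i \<noteq> 0 \<or> a \<noteq> 0 \<or> b \<noteq> 0 \<Longrightarrow> coef \<phi> i j a b = coef \<psi> i j a b"
  shows "\<phi> = \<psi>"
proof
  interpret f: Vector_Spaces.linear pscale "(*s)" \<phi> by (rule \<phi>)
  interpret g: Vector_Spaces.linear pscale "(*s)" \<psi> by (rule \<psi>)
  fix x
  show "\<phi> x = \<psi> x"
  proof (rule lin_eqI[OF \<phi> \<psi>])
    fix I
    obtain i a b where I: "expo I = mi i a b" by (metis mi_surj)
    have "\<phi> (dpow (mi i a b)) = \<psi> (dpow (mi i a b))"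
      using eq[of i a b] valid_expo[of I] unfolding I by (simp add: coef_def vec_eq_iff)
    then show "\<phi> (Poly_Mapping.single I 1) = \<psi> (Poly_Mapping.single I 1)"
      unfolding wmon_def[symmetric] wmon_e I by (simp add: f.scale g.scale del: mfact_mi)
  qed
qed

lemma coef_ext_zero:
  assumes "cochain_linear \<phi>" "\<And>i j a b. i \<le> 1 \<Longrightarrow> i \<noteq> 0 \<or> a \<noteq> 0 \<or> b \<noteq> 0 \<Longrightarrow> coef \<phi> i j a b = 0"
  shows "\<phi> = 0"
  using assms by (intro coef_ext cochain_linear_zero) simp_all

lemma L_iff: "\<phi> \<in> L n \<longleftrightarrow> cochain_linear \<phi> \<and> (\<forall>i j a b. i \<le> 1 \<longrightarrow> i + a + b \<noteq> n \<longrightarrow> coef \<phi> i j a b = 0)"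
proof (intro iffI conjI allI impI)
  assume "\<phi> \<in> L n"
  then have \<phi>: "cochain_linear \<phi>" and 0: "\<And>I. total (expo I) \<noteq> n \<Longrightarrow> \<phi> (wmon I) = 0" by (auto simp: L_def)
  interpret f: Vector_Spaces.linear pscale "(*s)" \<phi> by (rule \<phi>)
  show "cochain_linear \<phi>" by (rule \<phi>)
  fix i j a b assume i: "i \<le> (1 :: nat)" and n: "i + a + b \<noteq> n"
  show "coef \<phi> i j a b = 0"
  proof (cases "valid (mi i a b)")
    case True
    then show ?thesis using n 0[of "Midx (mi i a b)"] by (simp add: coef_def valid_e f.scale del: mfact_mi valid_mi)
  next
    \<comment> \<open>With \<open>i \<le> 1\<close> the only invalid index is 0, where
      \<open>dpow\<close> is 0.\<close>
    case False
    then show ?thesis by (simp only: coef_def dpow_def f.zero if_False zero_index)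
  qed
next
  assume *: "cochain_linear \<phi> \<and> (\<forall>i j a b. i \<le> 1 \<longrightarrow> i + a + b \<noteq> n \<longrightarrow> coef \<phi> i j a b = 0)"
  then interpret f: Vector_Spaces.linear pscale "(*s)" \<phi> by blast
  have "\<phi> (wmon I) = 0" if "total (expo I) \<noteq> n" for I
  proof -
    obtain i a b where I: "expo I = mi i a b" by (metis mi_surj)
    then have "\<phi> (dpow (mi i a b)) = 0"
      using * that valid_expo[of I] unfolding I by (simp add: coef_def vec_eq_iff)
    then show ?thesis unfolding wmon_e I by (simp add: f.scale del: mfact_mi)
  qed
  then show "\<phi> \<in> L n" using * by (simp add: L_def)
qed

text \<open>\<open>linext\<close> takes values in finitely supported functions, so the scalars are
  encoded as such functions on \<open>unit\<close>, separately for each \<open>j\<close>. The factor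
  \<open>mfact\<close> cancels the denominator in \<open>dpow\<close>, so that \<open>c\<close>
  prescribes the coefficients.\<close>

definition cochain :: "(nat \<Rightarrow> 3 \<Rightarrow> nat \<Rightarrow> nat \<Rightarrow> complex) \<Rightarrow> SW \<Rightarrow> W" where
  "cochain c x = (\<chi> j. Poly_Mapping.lookup (linext (\<lambda>I. Poly_Mapping.single ()
     (of_nat (mfact (expo I)) * c (expo I $ 1) j (expo I $ 2) (expo I $ 3))) x) ())"

lemma cochain_linear_cochain: "cochain_linear (cochain c)"
  by (rule cochain_linearI) (simp_all add: cochain_def linext_linear_simps lookup_add vec_eq_iff)

lemma coef_cochain:
  assumes "i \<le> 1" "i \<noteq> 0 \<or> a \<noteq> 0 \<or> b \<noteq> 0"
  shows "coef (cochain c) i j a b = c i j a b"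
  using assms by (simp add: coef_def cochain_def dpow_def linext_single del: mfact_mi)

lemma coef_dpow_zero: "cochain_linear \<phi> \<Longrightarrow> coef \<phi> 0 j 0 0 = 0"
  by (simp add: coef_def lin0)

section \<open>Coboundaries and classes\<close>

lemma D_d_sharp_diff:
  assumes "cochain_linear \<phi>" "cochain_linear \<psi>"
  shows "D d_sharp (\<phi> - \<psi>) = D d_sharp \<phi> - D d_sharp \<psi>"
\<comment> \<open>The coordinate formulas are linear in the coefficients; comparing them avoids
  arguing about the definite description in \<open>coext\<close>.\<close>
proof (rule coef_ext)
  show "cochain_linear (D d_sharp (\<phi> - \<psi>))" "cochain_linear (D d_sharp \<phi> - D d_sharp \<psi>)"
    using assms by (auto intro: cochain_linear_diff D_d_sharp_linear)
  fix i a b :: nat and j :: 3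
  assume "i \<le> 1"
  then consider "i = 0" | "i = 1" by linarith
  then show "coef (D d_sharp (\<phi> - \<psi>)) i j a b = coef (D d_sharp \<phi> - D d_sharp \<psi>) i j a b"
    using exhaust_3[of j] assms
    by cases (auto simp: coef_D cochain_linear_diff shift_y_def shift_z_def jordan_derivation_def algebra_simps simp del: One_nat_def)
qed

lemma coboundaries_diff:
  assumes "x \<in> coboundaries d_sharp n" "y \<in> coboundaries d_sharp n"
  shows "x - y \<in> coboundaries d_sharp n"
proof -
  obtain \<phi> \<psi> where *: "\<phi> \<in> L (n - 1)" "\<psi> \<in> L (n - 1)" "x = D d_sharp \<phi>" "y = D d_sharp \<psi>"
    using assms by (auto simp: coboundaries_def)
  then have "\<phi> - \<psi> \<in> L (n - 1)" by (simp add: L_iff cochain_linear_diff)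
  moreover have "x - y = D d_sharp (\<phi> - \<psi>)"
    using * by (simp add: L_iff D_d_sharp_diff)
  ultimately show ?thesis unfolding coboundaries_def by blast
qed

lemma zero_in_L: "0 \<in> L n"
  by (simp add: L_iff cochain_linear_zero)

lemma zero_in_coboundaries: "0 \<in> coboundaries d_sharp n"
  using coboundaries_diff[of "D d_sharp 0" n "D d_sharp 0"] zero_in_L[of "n - 1"]
  by (simp add: coboundaries_def)

lemma coboundaries_add:
  assumes "x \<in> coboundaries d_sharp n" "y \<in> coboundaries d_sharp n"
  shows "x + y \<in> coboundaries d_sharp n"
  using coboundaries_diff[OF assms(1) coboundaries_diff[OF zero_in_coboundaries assms(2)]] by simp

lemma cls_eqI:
  assumes "x - y \<in> coboundaries d_sharp n"
  shows "cls d_sharp n x = cls d_sharp n y"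
proof -
  have "cls d_sharp n u \<subseteq> cls d_sharp n v" if uv: "u - v \<in> coboundaries d_sharp n" for u v
  proof
    fix w assume "w \<in> cls d_sharp n u"
    then obtain b where b: "b \<in> coboundaries d_sharp n" "w = u + b" by (auto simp: cls_def)
    then have "w = v + ((u - v) + b)" by (simp add: algebra_simps)
    then show "w \<in> cls d_sharp n v" using coboundaries_add[OF uv b(1)] unfolding cls_def by blast
  qed
  moreover have "y - x \<in> coboundaries d_sharp n"
    using coboundaries_diff[OF zero_in_coboundaries assms] by simp
  ultimately show ?thesis using assms by blast
qed

lemma cls_eq_zeroD: "cls d_sharp n x = cls d_sharp n 0 \<Longrightarrow> x \<in> coboundaries d_sharp n"
  using zero_in_coboundaries[of n] unfolding cls_def by force

text \<open>Replaces equality of cosets by membership of differences in the coboundaries.\<close>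

lemma cohomology_basisI:
  assumes "set bs \<subseteq> cocycles d_sharp n"
    and "\<And>cs. length cs = length bs \<Longrightarrow> lincomb cs bs \<in> coboundaries d_sharp n \<Longrightarrow> \<forall>c\<in>set cs. c = 0"
    and "\<And>z. z \<in> cocycles d_sharp n \<Longrightarrow> \<exists>cs. length cs = length bs \<and> z - lincomb cs bs \<in> coboundaries d_sharp n"
  shows "cohomology_basis d_sharp n bs"
  unfolding cohomology_basis_def H_def using assms by (auto dest: cls_eq_zeroD) (metis cls_eqI)

section \<open>Cocycle equations and the inversion of E - c\<close>

lemma cocycles_iff:
  "\<phi> \<in> cocycles d_sharp n \<longleftrightarrow> \<phi> \<in> L n \<and> (\<forall>a b.
     coef \<phi> 0 1 a b = 0 \<and>
     jordan_derivation (coef \<phi> 0 2) a b = coef \<phi> 0 2 a b + shift_y (coef \<phi> 1 1) a b \<and>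
     jordan_derivation (coef \<phi> 0 3) a b = coef \<phi> 0 3 a b + coef \<phi> 0 2 a b + shift_y (coef \<phi> 1 1) a b + shift_z (coef \<phi> 1 1) a b)"
  (is "_ \<longleftrightarrow> _ \<and> ?eqs")
proof (cases "cochain_linear \<phi>")
  case \<phi>: True
  have "D d_sharp \<phi> = 0 \<longleftrightarrow> ?eqs"
  proof
    assume "D d_sharp \<phi> = 0"
    then have 0: "coef (D d_sharp \<phi>) i j a b = 0" for i j a b by simp
    show ?eqs
    proof (intro allI conjI)
      fix a b
      show "coef \<phi> 0 1 a b = 0"
        \<comment> \<open>Multiplication by \<open>y\<close> is injective: the coefficient at
          \<open>Suc a\<close> of y f_1 is that of f_1 at \<open>a\<close>. Once f_1 = 0, only the
          equations for g_2 and g_3 carry information.\<close>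
        using 0[of 0 2 "Suc a" b] by (simp add: coef_D[OF \<phi>] shift_y_def)
      show "jordan_derivation (coef \<phi> 0 2) a b = coef \<phi> 0 2 a b + shift_y (coef \<phi> 1 1) a b"
        using 0[of 1 2 a b] by (simp add: coef_D[OF \<phi>] algebra_simps del: One_nat_def)
      show "jordan_derivation (coef \<phi> 0 3) a b = coef \<phi> 0 3 a b + coef \<phi> 0 2 a b + shift_y (coef \<phi> 1 1) a b + shift_z (coef \<phi> 1 1) a b"
        using 0[of 1 3 a b] by (simp add: coef_D[OF \<phi>] algebra_simps del: One_nat_def)
    qed
  next
    assume eqs: ?eqs
    show "D d_sharp \<phi> = 0"
    proof (rule coef_ext_zero[OF D_d_sharp_linear[OF \<phi>]])
      fix i a b :: nat and j :: 3
      assume "i \<le> 1"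
      then consider "i = 0" | "i = 1" by linarith
      then show "coef (D d_sharp \<phi>) i j a b = 0"
        using exhaust_3[of j] eqs
        by cases (auto simp: coef_D[OF \<phi>] shift_y_def shift_z_def jordan_derivation_def[of "coef \<phi> 0 1"] simp del: One_nat_def)
    qed
  qed
  then show ?thesis by (simp add: cocycles_def)
next
  case False
  then show ?thesis by (simp add: cocycles_def L_def)
qed

text \<open>Inverse of \<open>jordan_derivation - c\<close> in every degree other than \<open>c\<close>; in degree \<open>c\<close> the value is junk (division by zero).\<close>

primrec resolvent :: "nat \<Rightarrow> (nat \<Rightarrow> nat \<Rightarrow> complex) \<Rightarrow> nat \<Rightarrow> nat \<Rightarrow> complex" where
  "resolvent c R 0 b = R 0 b / (of_nat b - of_nat c)"
| "resolvent c R (Suc a) b = (R (Suc a) b - of_nat (b + 1) * resolvent c R a (b + 1)) / (of_nat (Suc a + b) - of_nat c)"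

lemma resolvent_homogeneous:
  assumes "\<And>a b. a + b \<noteq> n \<Longrightarrow> R a b = 0"
  shows "a + b \<noteq> n \<Longrightarrow> resolvent c R a b = 0"
  by (induction a arbitrary: b) (auto simp: assms)

text \<open>At a given index the equation involves the unknown there and one entry with smaller
  \<open>a\<close> in the same degree, so the recursion solves it; its denominator in degree
  \<open>n\<close> is \<open>n - c\<close>.\<close>

lemma jordan_derivation_resolvent:
  assumes R: "\<And>a b. a + b \<noteq> n \<Longrightarrow> R a b = 0" and "n \<noteq> c"
  shows "jordan_derivation (resolvent c R) a b = of_nat c * resolvent c R a b + R a b"
proof (cases "a + b = n")
  case True
  then have "(of_nat (a + b) :: complex) - of_nat c \<noteq> 0" using \<open>n \<noteq> c\<close> by simp
  moreover have "r * (p - c') = q \<Longrightarrow> p * r = c' * r + q" for r p q c' :: complex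
    by (auto simp: algebra_simps)
  ultimately show ?thesis
    by (cases a) (simp_all add: jordan_derivation_def field_simps)
next
  case False
  then show ?thesis
    using R by (auto simp: jordan_derivation_def resolvent_homogeneous[of n R])
qed

text \<open>Uniqueness to match the resolvent: the off-diagonal part of E raises the power of y, so
  induction on \<open>a\<close> leaves only the factor \<open>n - c\<close>.\<close>

lemma jordan_derivation_eigen_zero:
  assumes X: "\<And>a b. jordan_derivation X a b = of_nat c * X a b" and 0: "\<And>a b. a + b \<noteq> n \<Longrightarrow> X a b = 0"
    and "n \<noteq> c"
  shows "X a b = 0"
proof (induction a arbitrary: b)
  case 0
  then show ?case using X[of 0 b] assms(2)[of 0 b] \<open>n \<noteq> c\<close> by (auto simp: jordan_derivation_def)
next
  case (Suc a)
  have "(of_nat (Suc a + b) - of_nat c) * X (Suc a) b = 0"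
    using X[of "Suc a" b] Suc by (simp add: jordan_derivation_def algebra_simps)
  then show ?case using assms(2)[of "Suc a" b] \<open>n \<noteq> c\<close> by (cases "Suc a + b = n") (auto simp del: of_nat_add of_nat_Suc)
qed

section \<open>Leibniz rules, potentials of cocycles, and exactness in degrees above 2\<close>

lemma jordan_derivation_shift_y:
  "jordan_derivation (shift_y F) a b = shift_y (jordan_derivation F) a b + shift_y F a b"
  by (cases a) (auto simp: jordan_derivation_def shift_y_def algebra_simps)

text \<open>The Leibniz rule for the derivation E with E z = y + z, as the previous lemma is the one
  with E y = y.\<close>

lemma jordan_derivation_shift_z:
  "jordan_derivation (shift_z F) a b = shift_z (jordan_derivation F) a b + shift_z F a b + shift_y F a b"
  by (cases a; cases b) (auto simp: jordan_derivation_def shift_y_def shift_z_def algebra_simps)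

lemma jordan_derivation_add: "jordan_derivation (\<lambda>a b. F a b + G a b) a b = jordan_derivation F a b + jordan_derivation G a b"
  and jordan_derivation_diff: "jordan_derivation (\<lambda>a b. F a b - G a b) a b = jordan_derivation F a b - jordan_derivation G a b"
  by (simp_all add: jordan_derivation_def algebra_simps)

text \<open>The bound \<open>n \<ge> 2\<close> enters twice: E is inverted in degree
  \<open>n - 1\<close>, which must differ from 0, and E - 1 must be injective in degree
  \<open>n\<close>, which must differ from 1.\<close>

lemma cocycle_potential:
  assumes z: "z \<in> cocycles d_sharp n" and n: "n \<ge> 2"
  obtains h where "\<And>a b. a + b \<noteq> n - 1 \<Longrightarrow> h a b = 0" "\<And>a b. jordan_derivation h a b = coef z 1 1 a b"
    "\<And>a b. coef z 0 2 a b = shift_y h a b" "\<And>a b. coef z 0 3 a b = shift_y h a b + shift_z h a b"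
proof -
  have zL: "coef z i j a b = 0" if "i \<le> 1" "i + a + b \<noteq> n" for i j a b
    using z that by (auto simp: cocycles_iff L_iff)
  have z2: "jordan_derivation (coef z 0 2) a b = coef z 0 2 a b + shift_y (coef z 1 1) a b"
    and z3: "jordan_derivation (coef z 0 3) a b = coef z 0 3 a b + coef z 0 2 a b + shift_y (coef z 1 1) a b + shift_z (coef z 1 1) a b" for a b
    using z unfolding cocycles_iff by blast+
  define h where "h = resolvent 0 (coef z 1 1)"
  have G: "coef z 1 1 a b = 0" if "a + b \<noteq> n - 1" for a b
    using that n by (intro zL) auto
  have h0: "h a b = 0" if "a + b \<noteq> n - 1" for a b
    unfolding h_def using G that by (rule resolvent_homogeneous)
  have h: "jordan_derivation h a b = coef z 1 1 a b" for a b
    using jordan_derivation_resolvent[of "n - 1" "coef z 1 1" 0, OF G] n by (simp add: h_def)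
  then have hf: "jordan_derivation h = coef z 1 1" by (intro ext)
  have 2: "coef z 0 2 a b = shift_y h a b" for a b
  proof -
    \<comment> \<open>By the Leibniz rule y h satisfies the same equation as f_2, so the difference
      is an eigenvector of E for the eigenvalue 1 in degree \<open>n\<close>.\<close>
    define X where "X = (\<lambda>a b. coef z 0 2 a b - shift_y h a b)"
    have "X a b = 0"
    proof (rule jordan_derivation_eigen_zero)
      show "jordan_derivation X a b = of_nat 1 * X a b" for a b
        unfolding X_def jordan_derivation_diff by (simp add: z2 jordan_derivation_shift_y hf del: One_nat_def)
      show "X a b = 0" if "a + b \<noteq> n" for a b
        using that n by (auto simp: X_def zL shift_y_def h0)
      show "n \<noteq> 1" using n by simp
    qed
    then show ?thesis by (simp add: X_def)
  qed
  then have Ff: "coef z 0 2 = shift_y h" by (intro ext)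
  have 3: "coef z 0 3 a b = shift_y h a b + shift_z h a b" for a b
  proof -
    \<comment> \<open>The same argument; the extra y h from E z = y + z matches the summand f_2 in
      the equation for f_3.\<close>
    define X where "X = (\<lambda>a b. coef z 0 3 a b - (shift_y h a b + shift_z h a b))"
    have "X a b = 0"
    proof (rule jordan_derivation_eigen_zero)
      show "jordan_derivation X a b = of_nat 1 * X a b" for a b
        unfolding X_def jordan_derivation_diff jordan_derivation_add
        by (simp add: z3 jordan_derivation_shift_y jordan_derivation_shift_z hf Ff del: One_nat_def)
      show "X a b = 0" if "a + b \<noteq> n" for a b
        using that n by (auto simp: X_def zL shift_y_def shift_z_def h0)
      show "n \<noteq> 1" using n by simp
    qed
    then show ?thesis by (simp add: X_def)
  qed
  show ?thesis by (rule that[OF h0 h 2 3])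
qed

text \<open>Here \<open>c\<close> lists the coefficients of a proposed primitive. The t-components
  are compared only for \<open>a + b = n - 1\<close>, since by homogeneity both sides vanish
  elsewhere.\<close>

lemma coboundariesI:
  fixes c :: "nat \<Rightarrow> 3 \<Rightarrow> nat \<Rightarrow> nat \<Rightarrow> complex"
  assumes z: "z \<in> L n"
    and supp: "\<And>i j a b. i \<le> 1 \<Longrightarrow> i + a + b \<noteq> n - 1 \<Longrightarrow> c i j a b = 0" and n: "n \<ge> 2"
    and c0: "\<And>a b. coef z 0 1 a b = 0"
    "\<And>a b. coef z 0 2 a b = shift_y (c 0 1) a b"
    "\<And>a b. coef z 0 3 a b = shift_y (c 0 1) a b + shift_z (c 0 1) a b"
    and c1: "\<And>a b. a + b = n - 1 \<Longrightarrow> coef z 1 1 a b = jordan_derivation (c 0 1) a b"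
    "\<And>a b. a + b = n - 1 \<Longrightarrow> coef z 1 2 a b = jordan_derivation (c 0 2) a b - c 0 2 a b - shift_y (c 1 1) a b"
    "\<And>a b. a + b = n - 1 \<Longrightarrow> coef z 1 3 a b = jordan_derivation (c 0 3) a b - c 0 3 a b - c 0 2 a b
       - shift_y (c 1 1) a b - shift_z (c 1 1) a b"
  shows "z \<in> coboundaries d_sharp n"
proof -
  have lin: "cochain_linear (cochain c)" by (rule cochain_linear_cochain)
  have coef_c: "coef (cochain c) i j a b = c i j a b" if "i \<le> 1" for i j a b
  proof (cases "i \<noteq> 0 \<or> a \<noteq> 0 \<or> b \<noteq> 0")
    case True
    with that show ?thesis by (rule coef_cochain)
  next
    case False
    \<comment> \<open>At index 0 a cochain has no free coefficient; since \<open>n - 1\<close> is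
      positive, \<open>supp\<close> makes \<open>c\<close> vanish there too.\<close>
    then show ?thesis using n supp[of i a b j] coef_dpow_zero[OF lin, of j] by simp
  qed
  then have cc: "coef (cochain c) 0 j = c 0 j" "coef (cochain c) 1 j = c 1 j" for j by (auto simp: fun_eq_iff)
  have "cochain c \<in> L (n - 1)"
    by (simp add: L_iff lin coef_c supp)
  moreover have "z = D d_sharp (cochain c)"
  proof (rule coef_ext)
    show "cochain_linear z" "cochain_linear (D d_sharp (cochain c))"
      using z by (auto simp: L_iff lin D_d_sharp_linear)
    fix i a b :: nat and j :: 3
    assume "i \<le> 1"
    have 0: "coef z 1 j a b = 0" "coef (D d_sharp (cochain c)) 1 j a b = 0" if "a + b \<noteq> n - 1"
    proof -
      show "coef z 1 j a b = 0" using z that n by (auto simp: L_iff)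
      show "coef (D d_sharp (cochain c)) 1 j a b = 0"
        using exhaust_3[of j] that n supp
        by (auto simp: coef_D[OF lin] cc jordan_derivation_def shift_y_def shift_z_def simp del: One_nat_def)
    qed
    consider "i = 0" | "i = 1" "a + b \<noteq> n - 1" | "i = 1" "a + b = n - 1" using \<open>i \<le> 1\<close> by linarith
    then show "coef z i j a b = coef (D d_sharp (cochain c)) i j a b"
    proof cases
      case 1
      then show ?thesis using exhaust_3[of j] by (auto simp: coef_D[OF lin] cc c0)
    next
      case 2
      then show ?thesis by (simp add: 0 del: One_nat_def)
    next
      case 3
      then show ?thesis using exhaust_3[of j] by (auto simp: coef_D[OF lin] cc c1 simp del: One_nat_def)
    qed
  qed
  ultimately show ?thesis unfolding coboundaries_def by blast
qed

lemma cocycle_is_coboundary: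
  assumes z: "z \<in> cocycles d_sharp n" and n: "n > 2"
  shows "z \<in> coboundaries d_sharp n"
proof -
  obtain h where h0: "\<And>a b. a + b \<noteq> n - 1 \<Longrightarrow> h a b = 0" and h: "\<And>a b. jordan_derivation h a b = coef z 1 1 a b"
    "\<And>a b. coef z 0 2 a b = shift_y h a b" "\<And>a b. coef z 0 3 a b = shift_y h a b + shift_z h a b"
    using cocycle_potential[OF z] n by (metis less_imp_le)
  have zL: "z \<in> L n" and z1: "coef z 0 1 a b = 0" for a b using z by (simp_all add: cocycles_iff)
  then have z0: "coef z 1 j a b = 0" if "a + b \<noteq> n - 1" for j a b
    using that n by (auto simp: L_iff)
  \<comment> \<open>Solves g_2 = E f_2 - f_2; since \<open>n > 2\<close>, the degree
    \<open>n - 1\<close> differs from 1 and E - 1 is invertible there.\<close>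
  define f2 where "f2 = resolvent 1 (coef z 1 2)"
  have f2_0: "f2 a b = 0" if "a + b \<noteq> n - 1" for a b
    unfolding f2_def by (rule resolvent_homogeneous[OF z0 that])
  have f2: "jordan_derivation f2 a b = f2 a b + coef z 1 2 a b" for a b
    unfolding f2_def using jordan_derivation_resolvent[of "n - 1" "coef z 1 2" 1, OF z0] n
    by (simp del: One_nat_def)
  \<comment> \<open>The equation g_3 = E f_3 - f_3 - f_2 has the solved f_2 moved to the right-hand
    side.\<close>
  define R where "R = (\<lambda>a b. coef z 1 3 a b + f2 a b)"
  have R0: "R a b = 0" if "a + b \<noteq> n - 1" for a b
    using that by (simp add: R_def z0 f2_0 del: One_nat_def)
  define f3 where "f3 = resolvent 1 R"
  have f3_0: "f3 a b = 0" if "a + b \<noteq> n - 1" for a b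
    unfolding f3_def by (rule resolvent_homogeneous[OF R0 that])
  have f3: "jordan_derivation f3 a b = f3 a b + R a b" for a b
    unfolding f3_def using jordan_derivation_resolvent[of "n - 1" R 1, OF R0] n
    by simp
  \<comment> \<open>The primitive has no t-components. Its component 1 is the potential
    \<open>h\<close>, which accounts for g_1 and for the t-free part of the cocycle.\<close>
  define c :: "nat \<Rightarrow> 3 \<Rightarrow> nat \<Rightarrow> nat \<Rightarrow> complex" where
    "c i j = (if i = 0 then if j = 1 then h else if j = 2 then f2 else f3 else (\<lambda>a b. 0))" for i j
  have c: "c 0 1 = h" "c 0 2 = f2" "c 0 3 = f3" "c 1 j = (\<lambda>a b. 0)" for j by (simp_all add: c_def)
  show ?thesis
  proof (rule coboundariesI[OF zL, of c])
    show "c i j a b = 0" if "i \<le> 1" "i + a + b \<noteq> n - 1" for i j a b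
      using that by (auto simp: c_def h0 f2_0 f3_0)
  qed (use n in \<open>simp_all add: c z1 h f2 f3 R_def shift_y_def shift_z_def del: One_nat_def\<close>)
qed

section \<open>Linear combinations and cohomology in degree 1\<close>

lemma lincomb_Cons: "lincomb (c # cs) (f # fs) x = c *s f x + lincomb cs fs x"
  by (simp add: lincomb_def sum.lessThan_Suc_shift del: sum.lessThan_Suc)

lemma lincomb_Nil: "lincomb cs [] x = 0"
  by (simp add: lincomb_def)

lemma coef_lincomb [simp]:
  "coef (lincomb (c # cs) (f # fs)) i j a b = c * coef f i j a b + coef (lincomb cs fs) i j a b"
  "coef (lincomb cs []) i j a b = 0"
  by (simp_all add: coef_def lincomb_Cons lincomb_Nil)

lemma lincomb_linear:
  assumes "\<forall>f\<in>set fs. cochain_linear f" "length cs = length fs"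
  shows "cochain_linear (lincomb cs fs)"
  using assms(2,1)
proof (induction cs fs rule: list_induct2)
  case Nil
  show ?case by (rule cochain_linearI) (simp_all add: lincomb_Nil)
next
  case (Cons c cs f fs)
  then interpret f: Vector_Spaces.linear pscale "(*s)" f by simp
  interpret g: Vector_Spaces.linear pscale "(*s)" "lincomb cs fs" using Cons by simp
  show ?case
    by (rule cochain_linearI)
      (simp_all add: lincomb_Cons f.add f.scale g.add g.scale vec_eq_iff algebra_simps)
qed

text \<open>There are no nonzero cochains of degree 0, so in degree 1 cohomology amounts to the
  space of cocycles.\<close>

lemma coboundaries_1: "coboundaries d_sharp 1 = {0}"
proof -
  have "\<phi> = 0" if "\<phi> \<in> L 0" for \<phi>
    using that by (intro coef_ext_zero) (auto simp: L_iff)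
  then have "L 0 = {0}" using zero_in_L[of 0] by blast
  moreover have "D d_sharp 0 = 0"
    using D_d_sharp_diff[of 0 0] by (simp add: cochain_linear_zero)
  ultimately show ?thesis by (simp add: coboundaries_def)
qed

lemma cohomology_basis_1:
  "cohomology_basis d_sharp 1
     [psi (1, 0, 0) 2, psi (1, 0, 0) 3, phi (0, 1, 0) 3, phi (0, 1, 0) 2 + phi (0, 0, 1) 3]"
  (is "cohomology_basis _ _ ?bs")
proof (rule cohomology_basisI)
  have lin: "\<forall>f\<in>set ?bs. cochain_linear f"
    by (simp add: phi_linear cochain_linear_add)
  show "set ?bs \<subseteq> cocycles d_sharp 1"
    by (auto simp: cocycles_iff L_iff phi_linear cochain_linear_add coef_phi
      jordan_derivation_def shift_y_def shift_z_def)
  show "\<forall>c\<in>set cs. c = 0" if len: "length cs = length ?bs" and cob: "lincomb cs ?bs \<in> coboundaries d_sharp 1" for cs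
  proof -
    have 0: "coef (lincomb cs ?bs) i j a b = 0" for i j a b
      using cob unfolding coboundaries_1 by simp
    obtain c1 c2 c3 c4 where cs: "cs = [c1, c2, c3, c4]"
      using len by (auto simp: length_Suc_conv)
    show ?thesis
      using 0[of 1 2 0 0] 0[of 1 3 0 0] 0[of 0 3 1 0] 0[of 0 2 1 0] by (simp add: cs coef_phi)
  qed
  show "\<exists>cs. length cs = length ?bs \<and> z - lincomb cs ?bs \<in> coboundaries d_sharp 1"
    if z: "z \<in> cocycles d_sharp 1" for z
  proof (intro exI conjI)
    \<comment> \<open>At each of these four positions exactly one of the listed elements has a
      nonzero coefficient.\<close>
    let ?cs = "[coef z 1 2 0 0, coef z 1 3 0 0, coef z 0 3 1 0, coef z 0 2 1 0]"
    show "length ?cs = length ?bs" by simp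
    have zL: "cochain_linear z" "\<And>i j a b. i \<le> 1 \<Longrightarrow> i + a + b \<noteq> 1 \<Longrightarrow> coef z i j a b = 0"
      and z1: "\<And>a b. coef z 0 1 a b = 0"
      and z2: "\<And>a b. jordan_derivation (coef z 0 2) a b = coef z 0 2 a b + shift_y (coef z 1 1) a b"
      and z3: "\<And>a b. jordan_derivation (coef z 0 3) a b = coef z 0 3 a b + coef z 0 2 a b + shift_y (coef z 1 1) a b + shift_z (coef z 1 1) a b"
      using z unfolding cocycles_iff L_iff by blast+
    \<comment> \<open>The equations at y for f_2, and at z and y for f_3. The first two force g_1 =
      0, hence f_2 has no z-term; the third ties the z-term of f_3 to the y-term of f_2, which is
      why these occur as one basis element.\<close>
    have e: "coef z 0 2 0 1 = coef z 1 1 0 0" "coef z 0 2 0 1 + coef z 1 1 0 0 = 0"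
      "coef z 0 3 0 1 = coef z 0 2 1 0 + coef z 1 1 0 0"
      using z2[of 1 0] z3[of 0 1] z3[of 1 0] by (simp_all add: jordan_derivation_def shift_y_def shift_z_def)
    have G: "coef z 1 1 0 0 = 0" using e(1,2) by simp
    have "z = lincomb ?cs ?bs"
    proof (rule coef_ext[OF zL(1) lincomb_linear[OF lin]])
      fix i a b :: nat and j :: 3
      assume "i \<le> 1"
      consider "i + a + b \<noteq> 1" | "i = 1" "a = 0" "b = 0" | "i = 0" "a = 1" "b = 0" | "i = 0" "a = 0" "b = 1"
        by linarith
      then show "coef z i j a b = coef (lincomb ?cs ?bs) i j a b"
      proof cases
        case 1
        then have "coef (lincomb ?cs ?bs) i j a b = 0" by (auto simp: coef_phi)
        then show ?thesis using 1 zL(2) \<open>i \<le> 1\<close> by simp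
      qed (use exhaust_3[of j] G e z1 in \<open>auto simp: coef_phi\<close>)
    qed simp
    then show "z - lincomb ?cs ?bs \<in> coboundaries d_sharp 1" unfolding coboundaries_1 by simp
  qed
qed

section \<open>Cohomology in degree 2\<close>

lemma cohomology_basis_2: "cohomology_basis d_sharp 2 [psi (1, 0, 1) 2]"
proof (rule cohomology_basisI)
  show "set [psi (1, 0, 1) 2] \<subseteq> cocycles d_sharp 2"
    by (auto simp: cocycles_iff L_iff phi_linear coef_phi
      jordan_derivation_def shift_y_def shift_z_def)
  show "\<forall>c\<in>set cs. c = 0" if len: "length cs = length [psi (1, 0, 1) 2]"
    and cob: "lincomb cs [psi (1, 0, 1) 2] \<in> coboundaries d_sharp 2" for cs
  proof -
    obtain c where cs: "cs = [c]"
      using len by (auto simp: length_Suc_conv)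
    obtain \<phi> where "cochain_linear \<phi>" "lincomb cs [psi (1, 0, 1) 2] = D d_sharp \<phi>"
      using cob by (auto simp: coboundaries_def L_iff)
    \<comment> \<open>No coboundary has a tz-term in component 2: E f_2 - f_2 has no z-term for
      linear f_2, and y g_1 has none either. This coefficient therefore detects the class.\<close>
    then have "coef (lincomb cs [psi (1, 0, 1) 2]) 1 2 0 1 = 0"
      by (simp add: coef_D jordan_derivation_def shift_y_def del: One_nat_def)
    then show ?thesis by (simp add: cs coef_phi)
  qed
  show "\<exists>cs. length cs = length [psi (1, 0, 1) 2] \<and> z - lincomb cs [psi (1, 0, 1) 2] \<in> coboundaries d_sharp 2"
    if z: "z \<in> cocycles d_sharp 2" for z
  proof (intro exI conjI)
    let ?cs = "[coef z 1 2 0 1]"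
    let ?w = "lincomb ?cs [psi (1, 0, 1) 2]"
    show "length ?cs = length [psi (1, 0, 1) 2]" by simp
    obtain h where h0: "\<And>a b. a + b \<noteq> 1 \<Longrightarrow> h a b = 0" and h: "\<And>a b. jordan_derivation h a b = coef z 1 1 a b"
      "\<And>a b. coef z 0 2 a b = shift_y h a b" "\<And>a b. coef z 0 3 a b = shift_y h a b + shift_z h a b"
      using cocycle_potential[OF z] by auto
    have zL: "z \<in> L 2" and z1: "coef z 0 1 a b = 0" for a b using z by (simp_all add: cocycles_iff)
    have wlin: "cochain_linear ?w" by (rule lincomb_linear) (simp_all add: phi_linear)
    have wL: "z - ?w \<in> L 2"
      using zL using cochain_linear_diff[OF _ wlin] by (auto simp: L_iff coef_phi)
    \<comment> \<open>In degree 1 the operator E - 1 is nilpotent, so the primitive is sought as f_2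
      = p z, f_3 = r z, g_1 = q. The ty-term of component 2 requires p - q, the tz-term of component
      3 requires -p - q, and the ty-term of component 3 requires r - q; these are solved for p, q
      and r.\<close>
    define p where "p = (coef z 1 2 1 0 - coef z 1 3 0 1) / 2"
    define q where "q = - (coef z 1 2 1 0 + coef z 1 3 0 1) / 2"
    define c :: "nat \<Rightarrow> 3 \<Rightarrow> nat \<Rightarrow> nat \<Rightarrow> complex" where
      "c i j a b = (if i = 0 then if j = 1 then h a b
          else if a = 0 \<and> b = 1 then if j = 2 then p else coef z 1 3 1 0 + q else 0
        else if j = 1 \<and> a = 0 \<and> b = 0 then q else 0)" for i j a b
    have ch: "c 0 1 = h" by (simp add: c_def fun_eq_iff)
    have pq: "coef z 1 2 1 0 = p - q" "coef z 1 3 0 1 = - p - q"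
      by (simp_all add: p_def q_def field_simps)
    have ab: "a = 0 \<and> b = 1 \<or> a = 1 \<and> b = 0" if "a + b = 2 - 1" for a b :: nat using that by linarith
    show "z - ?w \<in> coboundaries d_sharp 2"
    proof (rule coboundariesI[OF wL, of c])
      show "c i j a b = 0" if "i \<le> 1" "i + a + b \<noteq> 2 - 1" for i j a b
        using that by (auto simp: c_def h0)
      fix a b :: nat
      assume "a + b = 2 - 1"
      note ab' = ab[OF this]
      show "coef (z - ?w) 1 2 a b = jordan_derivation (c 0 2) a b - c 0 2 a b - shift_y (c 1 1) a b"
        "coef (z - ?w) 1 3 a b = jordan_derivation (c 0 3) a b - c 0 3 a b - c 0 2 a b
           - shift_y (c 1 1) a b - shift_z (c 1 1) a b"
        using ab' pq by (auto simp: coef_phi jordan_derivation_def shift_y_def shift_z_def c_def simp del: One_nat_def)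
    qed (simp_all add: z1 h ch coef_phi)
  qed
qed

theorem mainTheorem5:
  shows "cohomology_basis d_sharp 1
           [psi (1, 0, 0) 2, psi (1, 0, 0) 3, phi (0, 1, 0) 3, phi (0, 1, 0) 2 + phi (0, 0, 1) 3]
       \<and> cohomology_basis d_sharp 2 [psi (1, 0, 1) 2]
       \<and> (\<forall>n>2. H d_sharp n = {cls d_sharp n 0})"
proof (intro conjI allI impI)
  fix n :: nat assume n: "n > 2"
  have "cls d_sharp n z = cls d_sharp n 0" if "z \<in> cocycles d_sharp n" for z
    using cocycle_is_coboundary[OF that n] by (intro cls_eqI) simp
  \<comment> \<open>A cocycle must exist, so that the image \<open>H\<close> is the singleton and
    not empty.\<close>
  moreover have "0 \<in> cocycles d_sharp n"
    by (simp add: cocycles_iff zero_in_L jordan_derivation_def shift_y_def shift_z_def)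
  ultimately show "H d_sharp n = {cls d_sharp n 0}"
    unfolding H_def by blast
qed (rule cohomology_basis_1 cohomology_basis_2)+

end
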